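(* Let $\Omega$ be a $C^1$ Riemannian manifold without boundary, of dimension $n$, and let $Z$ be an $(m,h)$ subset of $\Omega$. Let $N$ be a closed region in $\Omega$ with smooth boundary such that $Z\subset N$, and let $p\in Z\cap\partial N$. Then $$\kappa_1+\dots+\kappa_m\le h,$$ where $\kappa_1\le\kappa_2\le\dots\le\kappa_{n-1}$ are the principal curvatures of $\partial N$ at $p$ with respect to the unit normal that points into $N$.
   Context: A $C^1$ Riemannian manifold is a smooth manifold with a $C^1$ Riemannian metric $g$. Definition of $(m,h)$ subset: let $\Omega$ be a smooth manifold without boundary with a $C^1$ Riemannian metric $g$. A closed subset $Z\subset\Omega$ is an $(m,h)$ subset (or $(m,h)$ set) if, whenever $f:\Omega\to\mathbf{R}$ is a $C^2$ function such that $f|Z$ has a local maximum at $p\in Z$, we have $\operatorname{Trace}_m(\mathrm{D}^2f(p))\le h\,|\mathrm{D}f(p)|$. Here $\mathrm{D}^2f$ is the Hessian of $f$ with respect to $g$, $|\mathrm{D}f|$ is the norm of the derivative with respect to $g$, and $\operatorname{Trace}_m$ denotes the sum of the $m$ lowest eigenvalues (with respect to $g$, counted with multiplicity). Principal curvatures are signed so that the unit ball in Euclidean space has positive principal curvatures with respect to the inward normal. *)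

theory Defs
  imports "HOL-Analysis.Analysis"
begin

section \<open>Functions of class $C^k$\<close>

text \<open>Intended for open \<open>S\<close>: being \<open>C\<^sup>k\<^sup>+\<^sup>1\<close> means Frechet differentiable with all directional
  derivatives of class \<open>C\<^sup>k\<close>.\<close>

fun Ck_on :: "nat \<Rightarrow> ('b::euclidean_space \<Rightarrow> 'c::real_normed_vector) \<Rightarrow> 'b set \<Rightarrow> bool" where
  "Ck_on 0 f S \<longleftrightarrow> continuous_on S f"
| "Ck_on (Suc k) f S \<longleftrightarrow>
     (\<forall>x\<in>S. f differentiable (at x)) \<and> (\<forall>v. Ck_on k (\<lambda>x. frechet_derivative f (at x) v) S)"

definition smooth_on :: "('b::euclidean_space \<Rightarrow> 'c::real_normed_vector) \<Rightarrow> 'b set \<Rightarrow> bool" where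
  "smooth_on f S \<longleftrightarrow> (\<forall>k. Ck_on k f S)"

definition partial :: "'n \<Rightarrow> (real^'n \<Rightarrow> real) \<Rightarrow> real^'n \<Rightarrow> real" where
  "partial i F x = frechet_derivative F (at x) (axis i 1)"


section \<open>Smooth manifolds without boundary\<close>

text \<open>A chart is a pair of its domain and its coordinate map; the values of the coordinate map
  outside the domain are irrelevant.\<close>

type_synonym ('a, 'n) chart = "'a set \<times> ('a \<Rightarrow> real^'n)"

definition chart_inv :: "('a, 'n::finite) chart \<Rightarrow> real^'n \<Rightarrow> 'a" where
  "chart_inv c = inv_into (fst c) (snd c)"

definition transition :: "('a, 'n::finite) chart \<Rightarrow> ('a, 'n) chart \<Rightarrow> real^'n \<Rightarrow> real^'n" where
  "transition c d = snd d \<circ> chart_inv c"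

text \<open>The atlas \<open>A\<close> is not required to be maximal.\<close>

locale smooth_manifold =
  fixes X :: "'a topology" and A :: "('a, 'n::finite) chart set"
  assumes hausdorff: "Hausdorff_space X"
    and second_countable: "second_countable X"
    and chart_domain: "c \<in> A \<Longrightarrow> openin X (fst c)"
    and chart_range: "c \<in> A \<Longrightarrow> open (snd c ` fst c)"
    and chart_homeomorphic:
      "c \<in> A \<Longrightarrow> homeomorphic_map (subtopology X (fst c)) (top_of_set (snd c ` fst c)) (snd c)"
    and charts_cover: "(\<Union>c\<in>A. fst c) = topspace X"
    and charts_compatible:
      "c \<in> A \<Longrightarrow> d \<in> A \<Longrightarrow> smooth_on (transition c d) (snd c ` (fst c \<inter> fst d))"

text \<open>Pointwise objects (Hessian eigenvalues, length of the derivative, principal curvatures) are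
  computed in some chart around the point; they do not depend on the chart chosen.\<close>

definition chart_at :: "('a, 'n::finite) chart set \<Rightarrow> 'a \<Rightarrow> ('a, 'n) chart" where
  "chart_at A p = (SOME c. c \<in> A \<and> p \<in> fst c)"

definition Ck_function_on ::
  "('a, 'n::finite) chart set \<Rightarrow> nat \<Rightarrow> ('a \<Rightarrow> real) \<Rightarrow> 'a set \<Rightarrow> bool" where
  "Ck_function_on A k f U \<longleftrightarrow> (\<forall>c\<in>A. Ck_on k (f \<circ> chart_inv c) (snd c ` (U \<inter> fst c)))"

definition smooth_function_on ::
  "('a, 'n::finite) chart set \<Rightarrow> ('a \<Rightarrow> real) \<Rightarrow> 'a set \<Rightarrow> bool" where
  "smooth_function_on A f U \<longleftrightarrow> (\<forall>k. Ck_function_on A k f U)"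


section \<open>$C^1$ Riemannian metrics\<close>

text \<open>\<open>g c p\<close> is the matrix of components \<open>g\<^sub>i\<^sub>j\<close> of the metric at \<open>p\<close> in the chart \<open>c\<close>; it is only
  meaningful for \<open>p\<close> in the domain of \<open>c\<close>.\<close>

type_synonym ('a, 'n) metric = "('a, 'n) chart \<Rightarrow> 'a \<Rightarrow> real^'n^'n"

locale C1_riemannian_manifold = smooth_manifold X A
  for X :: "'a topology" and A :: "('a, 'n::finite) chart set" +
  fixes g :: "('a, 'n) metric"
  assumes metric_sym: "c \<in> A \<Longrightarrow> p \<in> fst c \<Longrightarrow> transpose (g c p) = g c p"
    and metric_pos: "c \<in> A \<Longrightarrow> p \<in> fst c \<Longrightarrow> v \<noteq> 0 \<Longrightarrow> v \<bullet> (g c p *v v) > 0"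
    and metric_C1: "c \<in> A \<Longrightarrow> Ck_on 1 (\<lambda>x. g c (chart_inv c x)) (snd c ` fst c)"
    and metric_transform:
      "c \<in> A \<Longrightarrow> d \<in> A \<Longrightarrow> p \<in> fst c \<Longrightarrow> p \<in> fst d \<Longrightarrow>
         J = matrix (frechet_derivative (transition c d) (at (snd c p))) \<Longrightarrow>
         g c p = transpose J ** g d p ** J"

definition metric_coeff ::
  "('a, 'n::finite) metric \<Rightarrow> ('a, 'n) chart \<Rightarrow> real^'n \<Rightarrow> real^'n^'n" where
  "metric_coeff g c x = g c (chart_inv c x)"

definition metric_inner ::
  "('a, 'n::finite) metric \<Rightarrow> ('a, 'n) chart \<Rightarrow> 'a \<Rightarrow> real^'n \<Rightarrow> real^'n \<Rightarrow> real" where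
  "metric_inner g c p u v = u \<bullet> (g c p *v v)"

text \<open>\<open>christoffel G x k i j\<close> is the symbol with upper index \<open>k\<close> and lower indices \<open>i\<close>, \<open>j\<close> of the
  Levi-Civita connection of the metric with coefficient matrix \<open>G\<close>.\<close>

definition christoffel ::
  "(real^'n \<Rightarrow> real^'n^'n) \<Rightarrow> real^'n \<Rightarrow> 'n::finite \<Rightarrow> 'n \<Rightarrow> 'n \<Rightarrow> real" where
  "christoffel G x k i j =
     (1/2) * (\<Sum>l\<in>UNIV. matrix_inv (G x) $ k $ l *
       (partial i (\<lambda>y. G y $ j $ l) x + partial j (\<lambda>y. G y $ i $ l) x
        - partial l (\<lambda>y. G y $ i $ j) x))"

text \<open>Covariant derivative at \<open>x\<close>, in the direction \<open>u\<close>, of the vector field with components \<open>V\<close>.\<close>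

definition covariant_deriv ::
  "(real^'n \<Rightarrow> real^'n^'n) \<Rightarrow> real^'n \<Rightarrow> real^'n::finite \<Rightarrow> (real^'n \<Rightarrow> real^'n) \<Rightarrow> real^'n" where
  "covariant_deriv G x u V =
     (\<chi> k. frechet_derivative V (at x) u $ k
           + (\<Sum>i\<in>UNIV. \<Sum>j\<in>UNIV. christoffel G x k i j * u $ i * V x $ j))"

definition hessian_coeff ::
  "(real^'n \<Rightarrow> real^'n^'n) \<Rightarrow> (real^'n \<Rightarrow> real) \<Rightarrow> real^'n \<Rightarrow> 'n::finite \<Rightarrow> 'n \<Rightarrow> real" where
  "hessian_coeff G F x i j =
     partial i (partial j F) x - (\<Sum>k\<in>UNIV. christoffel G x k i j * partial k F x)"

definition hessian ::
  "('a, 'n::finite) metric \<Rightarrow> ('a, 'n) chart \<Rightarrow> ('a \<Rightarrow> real) \<Rightarrow> 'a \<Rightarrow> real^'n \<Rightarrow> real^'n \<Rightarrow> real" where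
  "hessian g c f p u v =
     (\<Sum>i\<in>UNIV. \<Sum>j\<in>UNIV.
        hessian_coeff (metric_coeff g c) (f \<circ> chart_inv c) (snd c p) i j * u $ i * v $ j)"

definition deriv_norm ::
  "('a, 'n::finite) chart set \<Rightarrow> ('a, 'n) metric \<Rightarrow> ('a \<Rightarrow> real) \<Rightarrow> 'a \<Rightarrow> real" where
  "deriv_norm A g f p =
     (let c = chart_at A p; dF = (\<chi> i. partial i (f \<circ> chart_inv c) (snd c p))
      in sqrt (dF \<bullet> (matrix_inv (g c p) *v dF)))"


section \<open>Eigenvalues of a symmetric bilinear form with respect to an inner product\<close>

text \<open>The increasing list, with multiplicities, of the eigenvalues of the symmetric bilinear form
  \<open>B\<close> on the subspace \<open>T\<close> with respect to the inner product \<open>G\<close>. The list is unique, being sorted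
  with prescribed multiplicities, and exists by the spectral theorem; its length is \<open>dim T\<close>.\<close>

definition eigenvalues ::
  "(real^'n) set \<Rightarrow> (real^'n \<Rightarrow> real^'n \<Rightarrow> real) \<Rightarrow> (real^'n \<Rightarrow> real^'n::finite \<Rightarrow> real) \<Rightarrow> real list" where
  "eigenvalues T G B =
     (THE l. sorted l \<and>
        (\<forall>\<mu>. count_list l \<mu> = dim {v \<in> T. \<forall>w\<in>T. B v w = \<mu> * G v w}))"

definition trace_hessian ::
  "('a, 'n::finite) chart set \<Rightarrow> ('a, 'n) metric \<Rightarrow> nat \<Rightarrow> ('a \<Rightarrow> real) \<Rightarrow> 'a \<Rightarrow> real" where
  "trace_hessian A g m f p =
     (let c = chart_at A p
      in sum_list (take m (eigenvalues UNIV (metric_inner g c p) (hessian g c f p))))"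


section \<open>$(m,h)$ subsets\<close>

definition local_max_on :: "'a topology \<Rightarrow> ('a \<Rightarrow> real) \<Rightarrow> 'a set \<Rightarrow> 'a \<Rightarrow> bool" where
  "local_max_on X f Z p \<longleftrightarrow> p \<in> Z \<and> (\<exists>U. openin X U \<and> p \<in> U \<and> (\<forall>q \<in> Z \<inter> U. f q \<le> f p))"

definition mh_subset ::
  "'a topology \<Rightarrow> ('a, 'n::finite) chart set \<Rightarrow> ('a, 'n) metric \<Rightarrow> nat \<Rightarrow> real \<Rightarrow> 'a set \<Rightarrow> bool" where
  "mh_subset X A g m h Z \<longleftrightarrow>
     closedin X Z \<and>
     (\<forall>f p. Ck_function_on A 2 f (topspace X) \<longrightarrow> local_max_on X f Z p \<longrightarrow>
        trace_hessian A g m f p \<le> h * deriv_norm A g f p)"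


section \<open>Closed regions with smooth boundary and their principal curvatures\<close>

text \<open>Near each boundary point, the region is the set where a smooth function without critical
  points is nonnegative. The boundary is then the topological frontier.\<close>

definition smooth_region :: "'a topology \<Rightarrow> ('a, 'n::finite) chart set \<Rightarrow> 'a set \<Rightarrow> bool" where
  "smooth_region X A N \<longleftrightarrow>
     closedin X N \<and>
     (\<forall>p \<in> X frontier_of N. \<exists>U w.
        openin X U \<and> p \<in> U \<and> smooth_function_on A w U \<and>
        (\<forall>c\<in>A. \<forall>q \<in> U \<inter> fst c.
           frechet_derivative (w \<circ> chart_inv c) (at (snd c q)) \<noteq> (\<lambda>_. 0)) \<and>
        N \<inter> U = {q \<in> U. 0 \<le> w q})"

text \<open>The tangent space of the boundary at \<open>q\<close>, in the chart \<open>c\<close>: velocities at time 0 of curves in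
  the boundary through \<open>q\<close>. Differentiability of the curve at time 0 suffices, since the boundary
  is a smooth hypersurface.\<close>

definition boundary_tangent ::
  "'a topology \<Rightarrow> 'a set \<Rightarrow> ('a, 'n::finite) chart \<Rightarrow> 'a \<Rightarrow> (real^'n) set" where
  "boundary_tangent X N c q =
     {v. \<exists>\<gamma>. \<gamma> 0 = snd c q \<and> (\<gamma> has_vector_derivative v) (at (0::real)) \<and>
          (\<forall>\<^sub>F t in at 0. \<gamma> t \<in> snd c ` (fst c \<inter> X frontier_of N))}"

definition inward_unit_normal ::
  "'a topology \<Rightarrow> ('a, 'n::finite) metric \<Rightarrow> 'a set \<Rightarrow> ('a, 'n) chart \<Rightarrow> 'a \<Rightarrow> real^'n \<Rightarrow> bool" where
  "inward_unit_normal X g N c q \<nu> \<longleftrightarrow>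
     metric_inner g c q \<nu> \<nu> = 1 \<and>
     (\<forall>v \<in> boundary_tangent X N c q. metric_inner g c q \<nu> v = 0) \<and>
     (\<forall>\<^sub>F t in at_right 0. snd c q + t *\<^sub>R \<nu> \<in> snd c ` (fst c \<inter> N))"

text \<open>A \<open>C\<^sup>1\<close> extension, to a neighbourhood of \<open>p\<close>, of the inward unit normal field along the
  boundary, in the coordinates of \<open>c\<close>. Derivatives of the extension in directions tangent to the
  boundary do not depend on the extension.\<close>

definition normal_field ::
  "'a topology \<Rightarrow> ('a, 'n::finite) metric \<Rightarrow> 'a set \<Rightarrow> ('a, 'n) chart \<Rightarrow> 'a \<Rightarrow> (real^'n \<Rightarrow> real^'n) \<Rightarrow> bool"
  where
  "normal_field X g N c p V \<longleftrightarrow>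
     (\<exists>W. open W \<and> snd c p \<in> W \<and> W \<subseteq> snd c ` fst c \<and> Ck_on 1 V W \<and>
        (\<forall>q \<in> fst c \<inter> X frontier_of N. snd c q \<in> W \<longrightarrow>
           inward_unit_normal X g N c q (V (snd c q))))"

text \<open>The sign makes the boundary of the Euclidean unit ball positively curved: there the inward
  normal at \<open>x\<close> is \<open>- x\<close>, and the form is the inner product.\<close>

definition second_fundamental_form ::
  "'a topology \<Rightarrow> ('a, 'n::finite) metric \<Rightarrow> 'a set \<Rightarrow> ('a, 'n) chart \<Rightarrow> 'a \<Rightarrow> real^'n \<Rightarrow> real^'n \<Rightarrow> real"
  where
  "second_fundamental_form X g N c p u v =
     - metric_inner g c p
         (covariant_deriv (metric_coeff g c) (snd c p) u (SOME V. normal_field X g N c p V)) v"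

definition principal_curvatures ::
  "'a topology \<Rightarrow> ('a, 'n::finite) chart set \<Rightarrow> ('a, 'n) metric \<Rightarrow> 'a set \<Rightarrow> 'a \<Rightarrow> real list" where
  "principal_curvatures X A g N p =
     (let c = chart_at A p
      in eigenvalues (boundary_tangent X N c p) (metric_inner g c p)
           (second_fundamental_form X g N c p))"

end

theory Submission
  imports Defs
begin

text \<open>Near \<open>p\<close> write \<open>N = {w \<ge> 0}\<close>. For any \<open>C\<^sup>2\<close> function \<open>\<psi> \<ge> 0\<close> supported near \<open>p\<close>, the function
  \<open>f = - w \<psi>\<close> is at most \<open>0\<close> on \<open>N\<close> and vanishes at \<open>p\<close>, so \<open>f|Z\<close> has a maximum at \<open>p\<close>. If
  \<open>\<psi>(p) = 1\<close> then \<open>|Df(p)| = \<sigma>\<close> with \<open>\<sigma> = |Dw(p)|\<close>, and on tangent vectors of \<open>\<partial>N\<close> the Hessian of \<open>f\<close>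
  at \<open>p\<close> is \<open>\<sigma>\<close> times the second fundamental form. The first derivative of \<open>\<psi>\<close> at \<open>p\<close> is still free; it
  can be chosen so that the normal becomes an eigenvector of the Hessian with an eigenvalue above all
  \<open>\<sigma> \<kappa>\<^sub>i\<close>. The \<open>m\<close> lowest eigenvalues are then \<open>\<sigma> \<kappa>\<^sub>1, \<dots>, \<sigma> \<kappa>\<^sub>m\<close>, and the definition of an
  \<open>(m,h)\<close> subset gives the claim without any limit.\<close>

section \<open>Calculus of functions of class $C^k$\<close>

text \<open>The function \<open>- w\<close> alone has a maximum on \<open>Z\<close> at
  \<open>p\<close>, but this is too weak. By min-max, the lowest eigenvalues of a form are at most
  those of its restriction to a hyperplane, so mixed normal-tangential entries, or a small normal
  entry, can make the trace inequality for \<open>- w\<close> fall short of the claim.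

  The factor \<phi> = - \<psi> repairs this. Since w(p) = 0, the product rule adds dw(u) d\<phi>(v)
  + dw(v) d\<phi>(u) to the Hessian. This vanishes on pairs of tangent vectors and leaves the
  tangential block alone, while the n free components of d\<phi>(p) match the n entries of the
  normal row. So that row can be prescribed exactly: zero off the diagonal and a number \<Lambda>
  \<ge> \<sigma> \<kappa>_i on it. As m \<le> n - 1, \<Lambda> is not among the m eigenvalues that
  are summed.

  The metric is only C^1, so everything geometric is computed at \<open>p\<close> from first
  derivatives of its coefficients. The test functions in the definition of an (m,h) subset live on
  all of \<Omega>, which is why \<phi> needs compact support inside a chart.\<close>

lemma Ck_on_has_derivative:
  "Ck_on (Suc k) f S \<Longrightarrow> x \<in> S \<Longrightarrow> (f has_derivative frechet_derivative f (at x)) (at x)"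
  by (simp add: frechet_derivative_works[symmetric])

lemma Ck_on_cong:
  assumes "open S" "\<And>x. x \<in> S \<Longrightarrow> f x = g x" "Ck_on k f S"
  shows "Ck_on k g S"
  using assms(2,3)
proof (induction k arbitrary: f g)
  case 0
  then show ?case
    by (metis Ck_on.simps(1) continuous_on_cong)
next
  case (Suc k)
  have g: "(g has_derivative frechet_derivative f (at x)) (at x)" if "x \<in> S" for x
    using has_derivative_transform_within_open[OF Ck_on_has_derivative[OF Suc.prems(2) that] assms(1) that]
      Suc.prems(1) by blast
  have eq: "frechet_derivative f (at x) = frechet_derivative g (at x)" if "x \<in> S" for x
    using frechet_derivative_at[OF g[OF that]] .
  show ?case
    unfolding Ck_on.simps
  proof (intro conjI ballI allI)
    show "g differentiable at x" if "x \<in> S" for x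
      using g[OF that] differentiableI by blast
    show "Ck_on k (\<lambda>x. frechet_derivative g (at x) v) S" for v
      by (rule Suc.IH[of "\<lambda>x. frechet_derivative f (at x) v"]) (use Suc.prems eq in auto)
  qed
qed

lemma Ck_on_SucI:
  assumes "open S" "\<And>x. x \<in> S \<Longrightarrow> (f has_derivative f' x) (at x)" "\<And>v. Ck_on k (\<lambda>x. f' x v) S"
  shows "Ck_on (Suc k) f S"
  unfolding Ck_on.simps
proof (intro conjI ballI allI)
  show "f differentiable at x" if "x \<in> S" for x
    using assms(2)[OF that] differentiableI by blast
  show "Ck_on k (\<lambda>x. frechet_derivative f (at x) v) S" for v
    by (rule Ck_on_cong[OF assms(1) _ assms(3)[of v]]) (metis assms(2) frechet_derivative_at)
qed

lemma Ck_on_SucD: "Ck_on (Suc k) f S \<Longrightarrow> Ck_on k f S"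
proof (induction k arbitrary: f)
  case 0
  then show ?case
    by (simp add: continuous_at_imp_continuous_on differentiable_imp_continuous_within)
next
  case (Suc k)
  then show ?case
    by (metis Ck_on.simps(2))
qed

lemma Ck_on_subset: "Ck_on k f S \<Longrightarrow> T \<subseteq> S \<Longrightarrow> Ck_on k f T"
proof (induction k arbitrary: f)
  case 0
  then show ?case
    using continuous_on_subset by auto
qed auto

lemma Ck_on_Un: "open S \<Longrightarrow> open T \<Longrightarrow> Ck_on k f S \<Longrightarrow> Ck_on k f T \<Longrightarrow> Ck_on k f (S \<union> T)"
proof (induction k arbitrary: f)
  case 0
  then show ?case
    by (simp add: continuous_on_open_Un)
qed auto

lemma Ck_on_const: "Ck_on k (\<lambda>x. a) S"
proof (induction k arbitrary: a)
  case (Suc k)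
  then show ?case by simp
qed simp

lemma Ck_on_bounded_linear_compose:
  assumes "bounded_linear L" "open S" "Ck_on k f S"
  shows "Ck_on k (\<lambda>x. L (f x)) S"
  using assms(3)
proof (induction k arbitrary: f)
  case 0
  then show ?case
    using bounded_linear.continuous_on[OF assms(1)] by simp
next
  case (Suc k)
  show ?case
  proof (rule Ck_on_SucI[OF assms(2)])
    show "((\<lambda>x. L (f x)) has_derivative (\<lambda>v. L (frechet_derivative f (at x) v))) (at x)"
      if "x \<in> S" for x
      by (rule bounded_linear.has_derivative[OF assms(1) Ck_on_has_derivative[OF Suc.prems that]])
    show "Ck_on k (\<lambda>x. L (frechet_derivative f (at x) v)) S" for v
      using Suc by auto
  qed
qed

lemma Ck_on_ident: "open S \<Longrightarrow> Ck_on k (\<lambda>x. x) S"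
  by (cases k) (auto intro!: Ck_on_SucI Ck_on_const)

lemma Ck_on_add:
  assumes "open S" "Ck_on k f S" "Ck_on k g S"
  shows "Ck_on k (\<lambda>x. f x + g x) S"
  using assms(2,3)
proof (induction k arbitrary: f g)
  case 0
  then show ?case
    by (auto intro: continuous_intros)
next
  case (Suc k)
  show ?case
  proof (rule Ck_on_SucI[OF assms(1)])
    show "((\<lambda>x. f x + g x) has_derivative
        (\<lambda>v. frechet_derivative f (at x) v + frechet_derivative g (at x) v)) (at x)"
      if "x \<in> S" for x
      using that by (intro has_derivative_add Ck_on_has_derivative[OF Suc.prems(1)] Ck_on_has_derivative[OF Suc.prems(2)])
  qed (use Suc in auto)
qed

lemma Ck_on_sum:
  assumes "open S" "\<And>i. i \<in> I \<Longrightarrow> Ck_on k (f i) S"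
  shows "Ck_on k (\<lambda>x. \<Sum>i\<in>I. f i x) S"
  using assms(2)
  by (induction I rule: infinite_finite_induct) (auto intro: Ck_on_const Ck_on_add[OF assms(1)])

lemma Ck_on_bilinear:
  assumes "bounded_bilinear pr" "open S" "Ck_on k f S" "Ck_on k g S"
  shows "Ck_on k (\<lambda>x. pr (f x) (g x)) S"
  using assms(3,4)
proof (induction k arbitrary: f g)
  case 0
  then show ?case
    by (auto intro: bounded_bilinear.continuous_on[OF assms(1)])
next
  case (Suc k)
  show ?case
  proof (rule Ck_on_SucI[OF assms(2)])
    show "((\<lambda>x. pr (f x) (g x)) has_derivative
        (\<lambda>v. pr (f x) (frechet_derivative g (at x) v) + pr (frechet_derivative f (at x) v) (g x))) (at x)"
      if "x \<in> S" for x
      using that by (intro bounded_bilinear.FDERIV[OF assms(1)] Ck_on_has_derivative[OF Suc.prems(1)] Ck_on_has_derivative[OF Suc.prems(2)])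
    show "Ck_on k (\<lambda>x. pr (f x) (frechet_derivative g (at x) v) + pr (frechet_derivative f (at x) v) (g x)) S" for v
      using Suc.prems Ck_on_SucD[OF Suc.prems(1)] Ck_on_SucD[OF Suc.prems(2)]
      by (intro Ck_on_add[OF assms(2)] Suc.IH) auto
  qed
qed

lemmas Ck_on_mult = Ck_on_bilinear[OF bounded_bilinear_mult]
lemmas Ck_on_scaleR = Ck_on_bilinear[OF bounded_bilinear_scaleR]

lemma Ck_on_prod:
  fixes f :: "'i \<Rightarrow> 'b::euclidean_space \<Rightarrow> real"
  assumes "open S" "\<And>i. i \<in> I \<Longrightarrow> Ck_on k (f i) S"
  shows "Ck_on k (\<lambda>x. \<Prod>i\<in>I. f i x) S"
  using assms(2)
  by (induction I rule: infinite_finite_induct) (auto intro: Ck_on_const Ck_on_mult[OF assms(1)])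

text \<open>In the chain rule the direction \<open>Dg(x) v\<close> varies with \<open>x\<close>,
  whereas \<open>Ck_on\<close> controls the derivatives of \<open>f\<close> in fixed directions.
  Expanding the direction in the basis gives a finite sum of products to which the induction
  hypothesis applies.\<close>

lemma Ck_on_compose:
  fixes f :: "'b::euclidean_space \<Rightarrow> 'c::real_normed_vector" and g :: "'a::euclidean_space \<Rightarrow> 'b"
  assumes "open S" "open T" "g ` S \<subseteq> T" "Ck_on k g S" "Ck_on k f T"
  shows "Ck_on k (\<lambda>x. f (g x)) S"
  using assms(4,5)
proof (induction k arbitrary: f)
  case 0
  then show ?case
    using assms(3) by (auto intro: continuous_on_compose2)
next
  case (Suc k)
  show ?case
  proof (rule Ck_on_SucI[OF assms(1)])
    fix x assume x: "x \<in> S"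
    have f: "(f has_derivative frechet_derivative f (at (g x))) (at (g x))"
      using Ck_on_has_derivative[OF Suc.prems(2)] x assms(3) by blast
    have eq: "frechet_derivative f (at (g x)) v =
       (\<Sum>b\<in>Basis. (v \<bullet> b) *\<^sub>R frechet_derivative f (at (g x)) b)" for v
    proof -
      have lin: "linear (frechet_derivative f (at (g x)))"
        using f has_derivative_linear by blast
      have "frechet_derivative f (at (g x)) (\<Sum>b\<in>Basis. (v \<bullet> b) *\<^sub>R b) =
         (\<Sum>b\<in>Basis. (v \<bullet> b) *\<^sub>R frechet_derivative f (at (g x)) b)"
        by (simp add: linear_sum[OF lin] linear_cmul[OF lin])
      then show ?thesis
        by (simp add: euclidean_representation)
    qed
    show "((\<lambda>x. f (g x)) has_derivative
        (\<lambda>v. \<Sum>b\<in>Basis. (frechet_derivative g (at x) v \<bullet> b) *\<^sub>R frechet_derivative f (at (g x)) b)) (at x)"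
      using diff_chain_at[OF Ck_on_has_derivative[OF Suc.prems(1) x] f]
      unfolding o_def by (subst eq[symmetric])
  next
    fix v
    have "Ck_on k g S"
      using Suc.prems(1) by (rule Ck_on_SucD)
    then show "Ck_on k (\<lambda>x. \<Sum>b\<in>Basis. (frechet_derivative g (at x) v \<bullet> b) *\<^sub>R frechet_derivative f (at (g x)) b) S"
      using Suc.prems
      by (intro Ck_on_sum Ck_on_scaleR Suc.IH assms(1)
          Ck_on_bounded_linear_compose[OF bounded_linear_inner_left]) auto
  qed
qed

lemma Ck_on_vec_lambda:
  fixes f :: "'n::finite \<Rightarrow> 'b::euclidean_space \<Rightarrow> real"
  assumes "open S" "\<And>i. Ck_on k (f i) S"
  shows "Ck_on k (\<lambda>x. (\<chi> i. f i x) :: real^'n) S"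
proof -
  have "(\<chi> i. f i x) = (\<Sum>i\<in>UNIV. f i x *\<^sub>R axis i 1)" for x
    by (simp add: vec_eq_iff axis_def if_distrib cong: if_cong)
  then show ?thesis
    by (auto intro!: Ck_on_sum Ck_on_scaleR assms Ck_on_const)
qed

lemma Ck_on_vec_nth: "open S \<Longrightarrow> Ck_on k f S \<Longrightarrow> Ck_on k (\<lambda>x. f x $ i) S"
  by (rule Ck_on_bounded_linear_compose[OF bounded_linear_vec_nth])

lemma Ck_on_det:
  fixes M :: "'b::euclidean_space \<Rightarrow> real^'n^'n"
  assumes "open S" "\<And>i j. Ck_on k (\<lambda>x. M x $ i $ j) S"
  shows "Ck_on k (\<lambda>x. det (M x)) S"
  unfolding det_def by (intro Ck_on_sum Ck_on_mult Ck_on_prod assms Ck_on_const)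

lemma Ck_on_real_SucI:
  fixes f :: "real \<Rightarrow> real"
  assumes "open S" "\<And>t. t \<in> S \<Longrightarrow> (f has_real_derivative f' t) (at t)" "Ck_on k f' S"
  shows "Ck_on (Suc k) f S"
proof (rule Ck_on_SucI[OF assms(1)])
  show "(f has_derivative (*) (f' t)) (at t)" if "t \<in> S" for t
    using assms(2)[OF that] by (simp add: has_field_derivative_def)
  show "Ck_on k (\<lambda>x. f' x * v) S" for v
    by (intro Ck_on_mult assms Ck_on_const)
qed

lemma Ck_on_1_divide:
  fixes f g :: "'b::euclidean_space \<Rightarrow> real"
  assumes "open S" "Ck_on 1 f S" "Ck_on 1 g S" "\<And>x. x \<in> S \<Longrightarrow> g x \<noteq> 0"
  shows "Ck_on 1 (\<lambda>x. f x / g x) S"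
proof -
  have "Ck_on (Suc 0) inverse (- {0::real})"
    by (rule Ck_on_real_SucI[where f' = "\<lambda>t. - inverse (t^2)"])
      (auto intro!: derivative_eq_intros continuous_intros simp: power2_eq_square)
  then have "Ck_on (Suc 0) (\<lambda>x. inverse (g x)) S"
    by (rule Ck_on_compose[where T = "- {0}", rotated -1]) (use assms in auto)
  then show ?thesis
    unfolding divide_inverse by (intro Ck_on_mult assms) auto
qed

lemma Ck_on_1_sqrt:
  fixes g :: "'b::euclidean_space \<Rightarrow> real"
  assumes "open S" "Ck_on 1 g S" "\<And>x. x \<in> S \<Longrightarrow> g x > 0"
  shows "Ck_on 1 (\<lambda>x. sqrt (g x)) S"
proof -
  have "Ck_on (Suc 0) sqrt {0<..}"
    by (rule Ck_on_real_SucI[where f' = "\<lambda>t. inverse (sqrt t) / 2"])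
      (auto intro!: DERIV_real_sqrt continuous_intros)
  then have "Ck_on (Suc 0) (\<lambda>x. sqrt (g x)) S"
    by (rule Ck_on_compose[where T = "{0<..}", rotated -1]) (use assms in auto)
  then show ?thesis
    by simp
qed

lemma has_real_derivative_max_0_power:
  fixes t :: real
  shows "((\<lambda>t. max 0 t ^ Suc (Suc k)) has_real_derivative real (Suc (Suc k)) * max 0 t ^ Suc k) (at t)"
proof -
  consider "t > 0" | "t < 0" | "t = 0"
    by linarith
  then show ?thesis
  proof cases
    case 1
    have "((\<lambda>t. t ^ Suc (Suc k)) has_real_derivative real (Suc (Suc k)) * max 0 t ^ Suc k) (at t)"
      using DERIV_pow[of "Suc (Suc k)" t UNIV] 1 by simp
    then show ?thesis
      by (rule has_field_derivative_transform_within_open[where S = "{0<..}"]) (use 1 in auto)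
  next
    case 2
    have "((\<lambda>t. 0) has_real_derivative real (Suc (Suc k)) * max 0 t ^ Suc k) (at t)"
      using 2 by auto
    then show ?thesis
      by (rule has_field_derivative_transform_within_open[where S = "{..<0}"]) (use 2 in auto)
  next
    case 3
    \<comment> \<open>For either sign of \<open>h\<close> the difference quotient at 0 equals
      \<open>max 0 h ^ Suc k\<close>.\<close>
    have "((\<lambda>h::real. max 0 h ^ Suc k) \<longlongrightarrow> 0) (at 0)"
      by (auto intro!: tendsto_eq_intros)
    then have "((\<lambda>h::real. max 0 h ^ Suc (Suc k) / h) \<longlongrightarrow> 0) (at 0)"
      by (rule Lim_transform_eventually) (auto simp: eventually_at_filter max_def)
    then show ?thesis
      using 3 by (simp add: DERIV_def)
  qed
qed

text \<open>The profile of the later cut-off function: cubing the positive part smooths its corner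
  at 0 to class C^2, the regularity of the test functions in \<open>mh_subset\<close>.\<close>

lemma Ck_on_2_max_0_cube: "Ck_on 2 (\<lambda>t::real. max 0 t ^ 3) UNIV"
proof -
  have "Ck_on (Suc 0) (\<lambda>t::real. max 0 t ^ Suc (Suc 0)) UNIV"
    by (rule Ck_on_real_SucI[OF open_UNIV has_real_derivative_max_0_power])
      (auto intro!: continuous_intros)
  then have "Ck_on (Suc 0) (\<lambda>t::real. real (Suc (Suc 1)) * max 0 t ^ Suc 1) UNIV"
    by (intro Ck_on_mult Ck_on_const) auto
  then have "Ck_on (Suc (Suc 0)) (\<lambda>t::real. max 0 t ^ Suc (Suc 1)) UNIV"
    by (rule Ck_on_real_SucI[OF open_UNIV has_real_derivative_max_0_power])
  then show ?thesis
    by (simp add: numeral_2_eq_2 numeral_3_eq_3)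
qed

subsection \<open>Symmetry of second derivatives\<close>

text \<open>The mean value theorem applied twice: in direction \<open>u\<close> to the increment of
  \<open>F\<close> over \<open>t v\<close>, then in direction \<open>v\<close> to the derivative of
  \<open>F\<close> along \<open>u\<close>. The bound on \<open>t\<close> keeps the parallelogram
  inside the ball.\<close>

lemma Ck_on_2_second_difference:
  fixes F :: "'a::euclidean_space \<Rightarrow> real"
  assumes F: "Ck_on 2 F (ball x r)" and t: "0 < t" "t * (norm u + norm v) < r"
  obtains \<xi> \<eta> where "0 < \<xi>" "\<xi> < t" "0 < \<eta>" "\<eta> < t"
    "F (x + t *\<^sub>R u + t *\<^sub>R v) - F (x + t *\<^sub>R u) - F (x + t *\<^sub>R v) + F x =
     t * t * frechet_derivative (\<lambda>y. frechet_derivative F (at y) u) (at (x + \<xi> *\<^sub>R u + \<eta> *\<^sub>R v)) v"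
proof -
  let ?D = "\<lambda>y. frechet_derivative F (at y) u"
  have F1: "(F has_derivative frechet_derivative F (at y)) (at y)"
    and F2: "(?D has_derivative frechet_derivative ?D (at y)) (at y)" if "y \<in> ball x r" for y
    using that F by (auto simp: numeral_2_eq_2 frechet_derivative_works[symmetric])
  have inb: "x + a *\<^sub>R u + b *\<^sub>R v \<in> ball x r" if "0 \<le> a" "a \<le> t" "0 \<le> b" "b \<le> t" for a b
  proof -
    have "norm (a *\<^sub>R u + b *\<^sub>R v) \<le> a * norm u + b * norm v"
      using norm_triangle_ineq[of "a *\<^sub>R u" "b *\<^sub>R v"] that by simp
    also have "\<dots> \<le> t * norm u + t * norm v"
      using that by (intro add_mono mult_right_mono) auto
    also have "\<dots> < r"
      using t by (simp add: algebra_simps)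
    finally have "dist (x + a *\<^sub>R u + b *\<^sub>R v) x < r"
      by (simp add: dist_norm add.assoc)
    then show ?thesis
      by (simp add: dist_commute)
  qed
  have dline: "((\<lambda>s. x + s *\<^sub>R u + b *\<^sub>R v) has_derivative (\<lambda>h. h *\<^sub>R u)) (at s)" for s b
    by (auto intro!: derivative_eq_intros)
  have dF: "((\<lambda>s. F (x + s *\<^sub>R u + b *\<^sub>R v)) has_real_derivative ?D (x + s *\<^sub>R u + b *\<^sub>R v)) (at s)"
    if "0 \<le> s" "s \<le> t" "0 \<le> b" "b \<le> t" for s b
    using diff_chain_at[OF dline F1[OF inb[OF that]]]
      linear_cmul[OF has_derivative_linear[OF F1[OF inb[OF that]]]]
    by (simp add: has_field_derivative_def o_def mult_commute_abs)
  have "\<exists>\<xi>. \<xi> > 0 \<and> \<xi> < t \<and>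
     (F (x + t *\<^sub>R u + t *\<^sub>R v) - F (x + t *\<^sub>R u + 0 *\<^sub>R v)) - (F (x + 0 *\<^sub>R u + t *\<^sub>R v) - F (x + 0 *\<^sub>R u + 0 *\<^sub>R v))
     = (t - 0) * (?D (x + \<xi> *\<^sub>R u + t *\<^sub>R v) - ?D (x + \<xi> *\<^sub>R u + 0 *\<^sub>R v))"
    by (rule MVT2) (use t in \<open>auto intro!: DERIV_diff dF simp del: scaleR_zero_left\<close>)
  then obtain \<xi> where \<xi>: "\<xi> > 0" "\<xi> < t" and 1: "F (x + t *\<^sub>R u + t *\<^sub>R v) - F (x + t *\<^sub>R u) - F (x + t *\<^sub>R v) + F x
     = t * (?D (x + \<xi> *\<^sub>R u + t *\<^sub>R v) - ?D (x + \<xi> *\<^sub>R u + 0 *\<^sub>R v))"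
    by auto
  have dline2: "((\<lambda>s. x + \<xi> *\<^sub>R u + s *\<^sub>R v) has_derivative (\<lambda>h. h *\<^sub>R v)) (at s)" for s
    by (auto intro!: derivative_eq_intros)
  have dD: "((\<lambda>s. ?D (x + \<xi> *\<^sub>R u + s *\<^sub>R v)) has_real_derivative
      frechet_derivative ?D (at (x + \<xi> *\<^sub>R u + s *\<^sub>R v)) v) (at s)" if "0 \<le> s" "s \<le> t" for s
    using diff_chain_at[OF dline2 F2[OF inb[of \<xi> s]]]
      linear_cmul[OF has_derivative_linear[OF F2[OF inb[of \<xi> s]]]] \<xi> that
    by (simp add: has_field_derivative_def o_def mult_commute_abs)
  have "\<exists>\<eta>. \<eta> > 0 \<and> \<eta> < t \<and> ?D (x + \<xi> *\<^sub>R u + t *\<^sub>R v) - ?D (x + \<xi> *\<^sub>R u + 0 *\<^sub>R v)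
     = (t - 0) * frechet_derivative ?D (at (x + \<xi> *\<^sub>R u + \<eta> *\<^sub>R v)) v"
    by (rule MVT2) (use t dD in auto)
  then show ?thesis
    using that \<xi> 1 by auto
qed

text \<open>The second difference is symmetric in \<open>u\<close> and \<open>v\<close>. Hence one
  mixed derivative at some point near \<open>x\<close> equals the other at some other point near
  \<open>x\<close>, and continuity at \<open>x\<close> closes the gap. This is one half of the
  symmetry of the Hessian.\<close>

lemma Ck_on_2_frechet_derivative_commute:
  fixes F :: "'a::euclidean_space \<Rightarrow> real"
  assumes "Ck_on 2 F S" "open S" "x \<in> S"
  shows "frechet_derivative (\<lambda>y. frechet_derivative F (at y) u) (at x) v =
         frechet_derivative (\<lambda>y. frechet_derivative F (at y) v) (at x) u"
proof -
  obtain r where r: "r > 0" "ball x r \<subseteq> S"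
    using assms open_contains_ball by blast
  have F: "Ck_on 2 F (ball x r)"
    using Ck_on_subset[OF assms(1) r(2)] .
  define n where "n = norm u + norm v"
  define T where "T = r / (n + 1)"
  have n: "n \<ge> 0" by (simp add: n_def)
  have T: "T > 0" using n r by (simp add: T_def)
  have Tr: "t * n < r" if "0 < t" "t < T" for t
  proof -
    have "t * n \<le> t * (n + 1)" using that by simp
    also have "\<dots> < r" using that n by (simp add: T_def field_simps)
    finally show ?thesis .
  qed
  let ?A = "\<lambda>y. frechet_derivative (\<lambda>y. frechet_derivative F (at y) u) (at y) v"
  let ?B = "\<lambda>y. frechet_derivative (\<lambda>y. frechet_derivative F (at y) v) (at y) u"
  have cont: "isCont ?A x" "isCont ?B x"
    using F r by (simp_all add: numeral_2_eq_2 continuous_on_eq_continuous_at)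
  have "\<bar>?A x - ?B x\<bar> < e" if e: "e > 0" for e
  proof -
    obtain d1 where d1: "d1 > 0" "\<And>y. dist y x < d1 \<Longrightarrow> dist (?A y) (?A x) < e / 2"
      using cont(1) e unfolding continuous_at_eps_delta by (metis half_gt_zero)
    obtain d2 where d2: "d2 > 0" "\<And>y. dist y x < d2 \<Longrightarrow> dist (?B y) (?B x) < e / 2"
      using cont(2) e unfolding continuous_at_eps_delta by (metis half_gt_zero)
    define d where "d = min d1 d2"
    have d: "d > 0" using d1 d2 by (simp add: d_def)
    \<comment> \<open>The bound \<open>T\<close> keeps the parallelogram in the ball where
      \<open>F\<close> is C^2; \<open>d / (n + 1)\<close> brings all its points within
      \<open>d\<close> of \<open>x\<close>.\<close>
    define t where "t = min T (d / (n + 1)) / 2"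
    have t: "0 < t" "t < T"
      using T d n by (auto simp: t_def)
    have "t * (n + 1) \<le> d / (n + 1) / 2 * (n + 1)"
      unfolding t_def by (intro mult_right_mono divide_right_mono) (use n in auto)
    also have "\<dots> = d / 2"
      using n by (simp add: field_simps)
    finally have tn: "t * (n + 1) < d"
      using d by linarith
    have near: "dist (x + a *\<^sub>R u + b *\<^sub>R v) x < d" if "0 < a" "a < t" "0 < b" "b < t" for a b
    proof -
      have "norm (a *\<^sub>R u + b *\<^sub>R v) \<le> a * norm u + b * norm v"
        using norm_triangle_ineq[of "a *\<^sub>R u" "b *\<^sub>R v"] that by simp
      also have "\<dots> \<le> t * norm u + t * norm v"
        using that by (intro add_mono mult_right_mono) auto
      also have "\<dots> < d"
        using t tn by (simp add: n_def algebra_simps)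
      finally show ?thesis
        by (simp add: dist_norm add.assoc)
    qed
    obtain \<xi> \<eta> where 1: "0 < \<xi>" "\<xi> < t" "0 < \<eta>" "\<eta> < t"
      "F (x + t *\<^sub>R u + t *\<^sub>R v) - F (x + t *\<^sub>R u) - F (x + t *\<^sub>R v) + F x = t * t * ?A (x + \<xi> *\<^sub>R u + \<eta> *\<^sub>R v)"
      using Ck_on_2_second_difference[OF F t(1), of u v] Tr[OF t(1,2)] by (auto simp: n_def)
    obtain \<xi>' \<eta>' where 2: "0 < \<xi>'" "\<xi>' < t" "0 < \<eta>'" "\<eta>' < t"
      "F (x + t *\<^sub>R v + t *\<^sub>R u) - F (x + t *\<^sub>R v) - F (x + t *\<^sub>R u) + F x = t * t * ?B (x + \<xi>' *\<^sub>R v + \<eta>' *\<^sub>R u)"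
      using Ck_on_2_second_difference[OF F t(1), of v u] Tr[OF t(1,2)] by (auto simp: n_def add.commute)
    have swap: "x + a *\<^sub>R v + b *\<^sub>R u = x + b *\<^sub>R u + a *\<^sub>R v" for a b
      by simp
    have "t * t * ?A (x + \<xi> *\<^sub>R u + \<eta> *\<^sub>R v) = t * t * ?B (x + \<eta>' *\<^sub>R u + \<xi>' *\<^sub>R v)"
      using 1(5) 2(5) unfolding swap[of t t] swap[of \<xi>' \<eta>'] by linarith
    then have "?A (x + \<xi> *\<^sub>R u + \<eta> *\<^sub>R v) = ?B (x + \<eta>' *\<^sub>R u + \<xi>' *\<^sub>R v)"
      using t by simp
    moreover have "dist (?A (x + \<xi> *\<^sub>R u + \<eta> *\<^sub>R v)) (?A x) < e / 2"
      using d1(2) near[OF 1(1-4)] by (simp add: d_def)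
    moreover have "dist (?B (x + \<eta>' *\<^sub>R u + \<xi>' *\<^sub>R v)) (?B x) < e / 2"
      using d2(2) near[OF 2(3,4,1,2)] by (simp add: d_def)
    ultimately show ?thesis
      using dist_triangle_half_r[of "?B (x + \<eta>' *\<^sub>R u + \<xi>' *\<^sub>R v)" "?A x" e "?B x"]
      by (simp add: dist_real_def)
  qed
  from this[of "\<bar>?A x - ?B x\<bar>"] show ?thesis
    by (cases "?A x = ?B x") auto
qed

section \<open>Eigenvalues of a symmetric bilinear form\<close>

text \<open>The set whose dimension is counted in \<open>eigenvalues\<close>. The eigenvector
  equation is tested only against \<open>T\<close>, so the definition makes sense for a form on a
  subspace without passing to an operator.\<close>

definition eigenspace ::
  "(real^'n) set \<Rightarrow> (real^'n \<Rightarrow> real^'n \<Rightarrow> real) \<Rightarrow> (real^'n \<Rightarrow> real^'n::finite \<Rightarrow> real) \<Rightarrow> real \<Rightarrow> (real^'n) set" where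
  "eigenspace T G B \<mu> = {v \<in> T. \<forall>w\<in>T. B v w = \<mu> * G v w}"

lemma subspace_eigenspace:
  assumes "subspace T" "bilinear G" "bilinear B"
  shows "subspace (eigenspace T G B \<mu>)"
  using assms
  by (auto simp: subspace_def eigenspace_def bilinear_lzero bilinear_ladd bilinear_lmul algebra_simps)

text \<open>A sorted list is determined by its multiset, so exhibiting one list with the right
  multiplicities evaluates the \<open>THE\<close>.\<close>

lemma eigenvalues_unique:
  assumes "sorted l" "\<And>\<mu>. count_list l \<mu> = dim (eigenspace T G B \<mu>)"
  shows "eigenvalues T G B = l"
  unfolding eigenvalues_def
proof (rule the_equality)
  show "sorted l \<and> (\<forall>\<mu>. count_list l \<mu> = dim {v \<in> T. \<forall>w\<in>T. B v w = \<mu> * G v w})"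
    using assms by (simp add: eigenspace_def)
next
  fix l' assume l': "sorted l' \<and> (\<forall>\<mu>. count_list l' \<mu> = dim {v \<in> T. \<forall>w\<in>T. B v w = \<mu> * G v w})"
  then have "mset l' = mset l"
    using assms(2) by (intro multiset_eqI) (simp add: count_mset eigenspace_def)
  then show "l' = l"
    using assms(1) l' by (metis properties_for_sort)
qed

text \<open>An eigenvector \<nu> is orthogonal to its complement for \<open>B\<close> as well as for
  \<open>G\<close>. Thus the eigenspaces of the complement are those of \<open>T\<close> cut with
  it, and only the one for \<kappa> loses a dimension. This drives both the spectral theorem and the
  splitting of the Hessian into normal and tangential parts.\<close>

lemma dim_eigenspace_split:
  fixes T :: "(real^'n::finite) set" and G B :: "real^'n \<Rightarrow> real^'n \<Rightarrow> real"
  assumes T: "subspace T" and G: "bilinear G" "\<And>u v. G u v = G v u" "\<And>v. v \<noteq> 0 \<Longrightarrow> G v v > 0"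
    and B: "bilinear B" "\<And>u v. u \<in> T \<Longrightarrow> v \<in> T \<Longrightarrow> B u v = B v u"
    and \<nu>: "\<nu> \<in> T" "\<nu> \<noteq> 0" "\<And>w. w \<in> T \<Longrightarrow> B \<nu> w = \<kappa> * G \<nu> w"
  shows "dim (eigenspace T G B \<mu>) =
    dim (eigenspace {v \<in> T. G \<nu> v = 0} G B \<mu>) + (if \<mu> = \<kappa> then 1 else 0)"
proof -
  let ?T = "{v \<in> T. G \<nu> v = 0}" 
  have T': "subspace ?T"
    using T G(1) by (auto simp: subspace_def bilinear_rzero bilinear_radd bilinear_rmul)
  have G\<nu>: "G \<nu> \<nu> > 0" using G(3) \<nu>(2) by blast
  have split: "w - (G \<nu> w / G \<nu> \<nu>) *\<^sub>R \<nu> \<in> ?T" if "w \<in> T" for w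
    using that \<nu> G\<nu> T by (auto simp: bilinear_rsub[OF G(1)] bilinear_rmul[OF G(1)] subspace_diff subspace_scale)
  have eq: "eigenspace ?T G B \<mu> = eigenspace T G B \<mu> \<inter> ?T"
  proof
    show "eigenspace T G B \<mu> \<inter> ?T \<subseteq> eigenspace ?T G B \<mu>"
      by (auto simp: eigenspace_def)
    show "eigenspace ?T G B \<mu> \<subseteq> eigenspace T G B \<mu> \<inter> ?T"
    proof
      fix v assume v: "v \<in> eigenspace ?T G B \<mu>"
      then have v1: "v \<in> T" "G \<nu> v = 0" "\<And>w. w \<in> ?T \<Longrightarrow> B v w = \<mu> * G v w"
        by (auto simp: eigenspace_def)
      have v2: "B v \<nu> = 0" "G v \<nu> = 0"
        using B(2)[OF v1(1) \<nu>(1)] \<nu>(3)[OF v1(1)] v1(2) G(2)[of v \<nu>] by auto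
      \<comment> \<open>Both forms vanish on the pair of \<open>v\<close> and \<nu>, so
        \<open>w\<close> may be replaced by its component orthogonal to \<nu>.\<close>
      have "B v w = \<mu> * G v w" if "w \<in> T" for w
        using v1(3)[OF split[OF that]] v2
        by (simp add: bilinear_rsub[OF G(1)] bilinear_rmul[OF G(1)] bilinear_rsub[OF B(1)] bilinear_rmul[OF B(1)])
      then show "v \<in> eigenspace T G B \<mu> \<inter> ?T"
        using v1 by (auto simp: eigenspace_def)
    qed
  qed
  show ?thesis
  proof (cases "\<mu> = \<kappa>")
    case False
    have "v \<in> ?T" if "v \<in> eigenspace T G B \<mu>" for v
    proof -
      have v: "v \<in> T" "B v \<nu> = \<mu> * G v \<nu>"
        using that \<nu> by (auto simp: eigenspace_def)
      have "\<mu> * G \<nu> v = \<kappa> * G \<nu> v"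
        using v(2) B(2)[OF v(1) \<nu>(1)] \<nu>(3)[OF v(1)] G(2)[of v \<nu>] by metis
      then show ?thesis
        using v False by simp
    qed
    then have "eigenspace ?T G B \<mu> = eigenspace T G B \<mu>"
      unfolding eq by auto
    then show ?thesis
      using False by simp
  next
    case True
    let ?E = "eigenspace T G B \<mu>" and ?E' = "eigenspace ?T G B \<mu>"
    have sE: "subspace ?E" and sE': "subspace ?E'"
      using subspace_eigenspace T T' G(1) B(1) by blast+
    have \<nu>E: "\<nu> \<in> ?E"
      using \<nu> True by (auto simp: eigenspace_def)
    have "?E = span (insert \<nu> ?E')"
    proof
      show "span (insert \<nu> ?E') \<subseteq> ?E"
        by (rule span_minimal[OF _ sE]) (use \<nu>E eq in auto)
      show "?E \<subseteq> span (insert \<nu> ?E')"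
      proof
        fix v assume v: "v \<in> ?E"
        let ?c = "G \<nu> v / G \<nu> \<nu>"
        have "v - ?c *\<^sub>R \<nu> \<in> ?E"
          using v \<nu>E sE subspace_diff subspace_scale by blast
        moreover have "v - ?c *\<^sub>R \<nu> \<in> ?T"
          using v by (intro split) (auto simp: eigenspace_def)
        ultimately have "v - ?c *\<^sub>R \<nu> \<in> span (insert \<nu> ?E')"
          unfolding eq by (intro span_base) auto
        moreover have "?c *\<^sub>R \<nu> \<in> span (insert \<nu> ?E')"
          by (intro span_scale span_base) auto
        ultimately have "(v - ?c *\<^sub>R \<nu>) + ?c *\<^sub>R \<nu> \<in> span (insert \<nu> ?E')"
          by (rule span_add)
        then show "v \<in> span (insert \<nu> ?E')"
          by simp
      qed
    qed
    moreover have "\<nu> \<notin> span ?E'"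
      unfolding span_eq_iff[THEN iffD2, OF sE'] using G\<nu> by (simp add: eigenspace_def)
    ultimately show ?thesis
      using True by (simp add: dim_insert)
  qed
qed

text \<open>The case \<open>B = G\<close> of the previous count: the eigenspace for 1 is then the
  whole subspace.\<close>

lemma dim_orthogonal_split:
  fixes T :: "(real^'n::finite) set" and G :: "real^'n \<Rightarrow> real^'n \<Rightarrow> real"
  assumes "subspace T" "bilinear G" "\<And>u v. G u v = G v u" "\<And>v. v \<noteq> 0 \<Longrightarrow> G v v > 0"
    and "\<nu> \<in> T" "\<nu> \<noteq> 0"
  shows "dim T = dim {v \<in> T. G \<nu> v = 0} + 1"
proof -
  have "eigenspace S G G 1 = S" for S
    by (auto simp: eigenspace_def)
  then show ?thesis
    using dim_eigenspace_split[where B = G and \<kappa> = 1 and \<mu> = 1, OF assms(1-4) assms(2) _ assms(5,6)]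
      assms(3) by auto
qed

text \<open>The eigenvector maximises the Rayleigh quotient \<open>B v v / G v v\<close>. The
  quotient is homogeneous of degree 0, so the compact Euclidean unit sphere of \<open>T\<close>
  suffices as its domain.\<close>

lemma maximal_eigenvector_exists:
  fixes T :: "(real^'n::finite) set" and G B :: "real^'n \<Rightarrow> real^'n \<Rightarrow> real"
  assumes T: "subspace T" "T \<noteq> {0}" and G: "bilinear G" "\<And>u v. G u v = G v u" "\<And>v. v \<noteq> 0 \<Longrightarrow> G v v > 0"
    and B: "bilinear B" "\<And>u v. u \<in> T \<Longrightarrow> v \<in> T \<Longrightarrow> B u v = B v u"
  obtains \<nu> and \<kappa> :: real where "\<nu> \<in> T" "\<nu> \<noteq> 0" "\<And>w. w \<in> T \<Longrightarrow> B \<nu> w = \<kappa> * G \<nu> w"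
proof -
  let ?S = "T \<inter> sphere 0 1"
  obtain x where x: "x \<in> T" "x \<noteq> 0"
    using T subspace_0 by blast
  then have "x /\<^sub>R norm x \<in> ?S"
    using T(1) by (simp add: subspace_scale)
  then have "?S \<noteq> {}" by blast
  moreover have "compact ?S"
    by (simp add: closed_Int_compact closed_subspace[OF T(1)])
  moreover have "continuous_on ?S (\<lambda>v. B v v / G v v)"
  proof (rule continuous_on_divide)
    have "bounded_bilinear B" "bounded_bilinear G"
      using B(1) G(1) by (simp_all add: bilinear_conv_bounded_bilinear)
    note bb = this[THEN bounded_bilinear.continuous_on, OF continuous_on_id continuous_on_id]
    show "continuous_on ?S (\<lambda>v. B v v)" "continuous_on ?S (\<lambda>v. G v v)"
      by (rule bb)+
    show "\<forall>v\<in>?S. G v v \<noteq> 0"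
    proof
      fix v assume "v \<in> ?S"
      then have "v \<noteq> 0" by auto
      from G(3)[OF this] show "G v v \<noteq> 0" by simp
    qed
  qed
  ultimately have "\<exists>\<nu>\<in>?S. \<forall>v\<in>?S. B v v / G v v \<le> B \<nu> \<nu> / G \<nu> \<nu>"
    by (intro continuous_attains_sup)
  then obtain \<nu> where \<nu>: "\<nu> \<in> ?S" "\<And>v. v \<in> ?S \<Longrightarrow> B v v / G v v \<le> B \<nu> \<nu> / G \<nu> \<nu>"
    by (elim bexE) simp
  define \<kappa> where "\<kappa> = B \<nu> \<nu> / G \<nu> \<nu>"
  have \<nu>0: "\<nu> \<noteq> 0" using \<nu>(1) by auto
  \<comment> \<open>By maximality \<open>Q\<close> is nonnegative on \<open>T\<close> and vanishes
    at \<nu>. A null vector of a semidefinite form lies in its kernel, and that is the eigenvector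
    equation.\<close>
  define Q where "Q u v = \<kappa> * G u v - B u v" for u v
  have Q\<nu>: "Q \<nu> \<nu> = 0"
    using G(3)[OF \<nu>0] by (simp add: Q_def \<kappa>_def)
  have Qpos: "Q v v \<ge> 0" if v: "v \<in> T" for v
  proof (cases "v = 0")
    case True
    then show ?thesis
      by (simp add: Q_def bilinear_lzero[OF G(1)] bilinear_lzero[OF B(1)])
  next
    case False
    let ?u = "v /\<^sub>R norm v"
    have "?u \<in> ?S"
      using False v T(1) by (simp add: subspace_scale)
    from \<nu>(2)[OF this] have "B v v / G v v \<le> \<kappa>"
      using False by (simp add: \<kappa>_def bilinear_lmul[OF G(1)] bilinear_rmul[OF G(1)] bilinear_lmul[OF B(1)] bilinear_rmul[OF B(1)])
    then show ?thesis
      using G(3)[OF False] by (simp add: Q_def field_simps)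
  qed
  have "Q \<nu> w = 0" if w: "w \<in> T" for w
  proof (rule ccontr)
    assume nz: "Q \<nu> w \<noteq> 0"
    have *: "0 \<le> 2 * t * Q \<nu> w + t^2 * Q w w" for t
    proof -
      have "\<nu> + t *\<^sub>R w \<in> T"
        using \<nu>(1) w T(1) by (simp add: subspace_add subspace_scale)
      then have "0 \<le> Q (\<nu> + t *\<^sub>R w) (\<nu> + t *\<^sub>R w)"
        by (rule Qpos)
      also have "\<dots> = Q \<nu> \<nu> + t * (Q \<nu> w + Q w \<nu>) + t^2 * Q w w"
        unfolding Q_def bilinear_ladd[OF G(1)] bilinear_radd[OF G(1)] bilinear_ladd[OF B(1)] bilinear_radd[OF B(1)]
            bilinear_lmul[OF G(1)] bilinear_rmul[OF G(1)] bilinear_lmul[OF B(1)] bilinear_rmul[OF B(1)] real_scaleR_def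
        by algebra
      also have "Q w \<nu> = Q \<nu> w"
        using G(2)[of w \<nu>] B(2)[of w \<nu>] w \<nu>(1) by (simp add: Q_def)
      finally show ?thesis
        using Q\<nu> by simp
    qed
    \<comment> \<open>The 1 keeps the divisor positive even when \<open>Q w w = 0\<close>. With
      \<open>t = - Q \<nu> w / q\<close> the quadratic polynomial in \<open>t\<close> becomes
      negative.\<close>
    define q where "q = Q w w + 1"
    have q: "q > 0" using Qpos[OF w] by (simp add: q_def)
    have "0 \<le> 2 * (- Q \<nu> w / q) * Q \<nu> w + (- Q \<nu> w / q)^2 * Q w w"
      by (rule *)
    also have "\<dots> \<le> 2 * (- Q \<nu> w / q) * Q \<nu> w + (- Q \<nu> w / q)^2 * q"
      by (intro add_left_mono mult_left_mono) (auto simp: q_def)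
    also have "\<dots> = - ((Q \<nu> w)\<^sup>2 / q)"
      using q by (simp add: power2_eq_square field_simps)
    also have "\<dots> < 0"
      using nz q by simp
    finally show False by simp
  qed
  then have "B \<nu> w = \<kappa> * G \<nu> w" if "w \<in> T" for w
    using that by (simp add: Q_def)
  then show ?thesis
    using that \<nu>(1) \<nu>0 by blast
qed

text \<open>The spectral theorem, by splitting off one eigenvector at a time. Symmetry is asked for
  on \<open>T\<close> only, because the second fundamental form accepts all coordinate vectors but
  is shown symmetric just on tangent ones.\<close>

lemma eigenvalues_exist:
  fixes T :: "(real^'n::finite) set" and G B :: "real^'n \<Rightarrow> real^'n \<Rightarrow> real"
  assumes T: "subspace T" and G: "bilinear G" "\<And>u v. G u v = G v u" "\<And>v. v \<noteq> 0 \<Longrightarrow> G v v > 0"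
    and B: "bilinear B" "\<And>u v. u \<in> T \<Longrightarrow> v \<in> T \<Longrightarrow> B u v = B v u"
  shows "\<exists>l. sorted l \<and> length l = dim T \<and> (\<forall>\<mu>. count_list l \<mu> = dim (eigenspace T G B \<mu>))"
  using T B(2)
proof (induction "dim T" arbitrary: T)
  case 0
  then have "T = {0}"
    using subspace_0 by fastforce
  then have "eigenspace T G B \<mu> = {0}" for \<mu>
    by (auto simp: eigenspace_def bilinear_lzero[OF G(1)] bilinear_lzero[OF B(1)])
  then show ?case
    using 0 by (intro exI[of _ "[]"]) simp
next
  case (Suc n)
  have "T \<noteq> {0}"
    using Suc.hyps(2) by auto
  then obtain \<nu> \<kappa> where \<nu>: "\<nu> \<in> T" "\<nu> \<noteq> 0" "\<And>w. w \<in> T \<Longrightarrow> B \<nu> w = \<kappa> * G \<nu> w"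
    using maximal_eigenvector_exists[OF Suc.prems(1) _ G B(1) Suc.prems(2)] by metis
  let ?T = "{v \<in> T. G \<nu> v = 0}" 
  have T': "subspace ?T"
    using Suc.prems(1) G(1) by (auto simp: subspace_def bilinear_rzero bilinear_radd bilinear_rmul)
  have "dim T = dim ?T + 1"
    by (rule dim_orthogonal_split[OF Suc.prems(1) G \<nu>(1,2)])
  moreover from this obtain l where l: "sorted l" "length l = dim ?T" "\<And>\<mu>. count_list l \<mu> = dim (eigenspace ?T G B \<mu>)"
    using Suc.hyps(1)[of ?T] Suc.hyps(2) T' Suc.prems(2) by auto
  moreover have "count_list (sort (\<kappa> # l)) \<mu> = dim (eigenspace T G B \<mu>)" for \<mu>
    using dim_eigenspace_split[OF Suc.prems(1) G B(1) Suc.prems(2) \<nu>, of \<mu>] l(3)[of \<mu>]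
    by (auto simp flip: count_mset)
  ultimately show ?case
    by (intro exI[of _ "sort (\<kappa> # l)"]) (auto simp del: sort_key_simps)
qed

lemma count_list_map_mult:
  fixes l :: "real list"
  assumes "\<sigma> \<noteq> 0"
  shows "count_list (map ((*) \<sigma>) l) \<mu> = count_list l (\<mu> / \<sigma>)"
  by (induction l) (use assms in \<open>auto simp: field_simps\<close>)

text \<open>On the orthogonal complement of \<nu> the form \<open>H\<close> is \<sigma> times
  \<open>B\<close>, so its \<mu>-eigenspace there is that of \<open>B\<close> for
  \<open>\<mu> / \<sigma>\<close>. The bound on \<kappa> keeps the list sorted when \<kappa> is put
  last, beyond the reach of a sum of fewer entries.\<close>

lemma eigenvalues_append:
  fixes G H B :: "real^'n \<Rightarrow> real^'n::finite \<Rightarrow> real"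
  assumes G: "bilinear G" "\<And>u v. G u v = G v u" "\<And>v. v \<noteq> 0 \<Longrightarrow> G v v > 0"
    and H: "bilinear H" "\<And>u v. H u v = H v u"
    and \<nu>: "\<nu> \<noteq> 0" "\<And>w. H \<nu> w = \<kappa> * G \<nu> w"
    and T: "T = {v. G \<nu> v = 0}" and \<sigma>: "\<sigma> > 0" "\<And>u v. u \<in> T \<Longrightarrow> v \<in> T \<Longrightarrow> H u v = \<sigma> * B u v"
    and l: "sorted l" "\<And>\<mu>. count_list l \<mu> = dim (eigenspace T G B \<mu>)"
    and max: "\<And>x. x \<in> set l \<Longrightarrow> \<sigma> * x \<le> \<kappa>"
  shows "eigenvalues UNIV G H = map ((*) \<sigma>) l @ [\<kappa>]"
proof (rule eigenvalues_unique)
  have "sorted (map ((*) \<sigma>) l)"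
    using l(1) \<sigma>(1) by (auto simp: sorted_map intro: sorted_wrt_mono_rel[rotated])
  then show "sorted (map ((*) \<sigma>) l @ [\<kappa>])"
    using max by (auto simp: sorted_append)
  show "count_list (map ((*) \<sigma>) l @ [\<kappa>]) \<mu> = dim (eigenspace UNIV G H \<mu>)" for \<mu>
  proof -
    have "eigenspace T G H \<mu> = eigenspace T G B (\<mu> / \<sigma>)"
      using \<sigma> by (auto simp: eigenspace_def field_simps)
    then show ?thesis
      using dim_eigenspace_split[OF subspace_UNIV G H _ \<nu>, of \<mu>] \<sigma>(1) l(2)
      by (auto simp: count_list_map_mult T count_list_append)
  qed
qed

section \<open>Level sets in coordinates\<close>

text \<open>The coordinate components of the differential, not the Riemannian gradient, which is
  obtained from it by the inverse metric.\<close>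

definition gradient :: "(real^'n \<Rightarrow> real) \<Rightarrow> real^'n \<Rightarrow> real^'n::finite" where
  "gradient F x = (\<chi> i. partial i F x)"

lemma linear_axis_expansion:
  fixes L :: "real^'n::finite \<Rightarrow> 'c::real_vector"
  assumes "linear L"
  shows "L u = (\<Sum>i\<in>UNIV. u $ i *\<^sub>R L (axis i 1))"
proof -
  have "L u = L (\<Sum>i\<in>UNIV. u $ i *\<^sub>R axis i 1)"
    using basis_expansion[of u] by (simp add: scalar_mult_eq_scaleR)
  then show ?thesis
    by (simp add: linear_sum[OF assms] linear_cmul[OF assms])
qed

lemma frechet_derivative_axis_expansion:
  fixes F :: "real^'n::finite \<Rightarrow> 'c::real_normed_vector"
  assumes "F differentiable (at x)"
  shows "frechet_derivative F (at x) u = (\<Sum>i\<in>UNIV. u $ i *\<^sub>R frechet_derivative F (at x) (axis i 1))"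
  by (rule linear_axis_expansion[OF linear_frechet_derivative[OF assms]])

lemma gradient_inner:
  fixes F :: "real^'n::finite \<Rightarrow> real"
  assumes "F differentiable (at x)"
  shows "gradient F x \<bullet> u = frechet_derivative F (at x) u"
  using frechet_derivative_axis_expansion[OF assms, of u]
  by (simp add: gradient_def partial_def inner_vec_def mult.commute)

text \<open>Allows an identity that holds only on a hypersurface to be differentiated in tangent
  directions.\<close>

lemma derivative_along_curve_zero:
  fixes P :: "'a::real_normed_vector \<Rightarrow> real" and \<gamma> :: "real \<Rightarrow> 'a"
  assumes P: "(P has_derivative P') (at x)" and \<gamma>: "\<gamma> 0 = x" "(\<gamma> has_vector_derivative u) (at 0)"
    and ev: "\<forall>\<^sub>F t in at 0. P (\<gamma> t) = 0" and x: "P x = 0"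
  shows "P' u = 0"
proof -
  have "((P \<circ> \<gamma>) has_derivative (P' \<circ> (\<lambda>h. h *\<^sub>R u))) (at 0)"
    using \<gamma> P by (intro diff_chain_at) (auto simp: has_vector_derivative_def)
  then have "((\<lambda>_. 0) has_derivative (P' \<circ> (\<lambda>h. h *\<^sub>R u))) (at (0::real))"
    by (rule has_derivative_transform_eventually) (use ev x \<gamma> in auto)
  then have "P' \<circ> (\<lambda>h. h *\<^sub>R u) = (\<lambda>_. 0)"
    using has_derivative_const has_derivative_unique by blast
  then show ?thesis
    by (auto simp: fun_eq_iff dest: spec[of _ 1])
qed

text \<open>A curve in the level set is obtained by moving along a transversal vector \<open>n\<close> by an amount
  \<open>s t\<close> found with the intermediate value theorem. Differentiability at the base point alone
  makes every such \<open>s\<close> of order \<open>o(t)\<close>.\<close>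

lemma level_set_curve_exists:
  fixes w :: "'a::euclidean_space \<Rightarrow> real"
  assumes W: "open W" "x \<in> W" "continuous_on W w" and w: "(w has_derivative w') (at x)" "w x = 0"
    and n: "w' n = 1" and v: "w' v = 0"
  obtains \<gamma> where "\<gamma> 0 = x" "(\<gamma> has_vector_derivative v) (at (0::real))"
    "\<forall>\<^sub>F t in at 0. \<gamma> t \<in> W \<and> w (\<gamma> t) = 0"
proof -
  have lin: "linear w'" using w(1) by (rule has_derivative_linear)
  have w'_eq: "w' (t *\<^sub>R v + s *\<^sub>R n) = s" for s t
    using n v by (simp add: linear_add[OF lin] linear_cmul[OF lin])
  have approx: "\<exists>d>0. \<forall>y. norm y < d \<longrightarrow> \<bar>w (x + y) - w' y\<bar> \<le> e * norm y" if "e > 0" for e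
  proof -
    have "\<forall>e>0. \<exists>d>0. \<forall>y. norm (y - x) < d \<longrightarrow> norm (w y - w x - w' (y - x)) \<le> e * norm (y - x)"
      using w(1) unfolding has_derivative_at_alt by (rule conjunct2)
    with that obtain d where d: "d > 0" "\<forall>y. norm (y - x) < d \<longrightarrow> norm (w y - w x - w' (y - x)) \<le> e * norm (y - x)"
      by metis
    have "\<bar>w (x + y) - w' y\<bar> \<le> e * norm y" if "norm y < d" for y
      using d(2)[rule_format, of "x + y"] that w(2) by simp
    then show ?thesis
      using d(1) by blast
  qed
  \<comment> \<open>Absorption: the part of the right-hand side containing \<open>s\<close> is at
    most half of the left-hand side.\<close>
  have small: "\<bar>s\<bar> \<le> 2 * e * \<bar>t\<bar> * norm v"
    if "e > 0" "e * norm n \<le> 1/2" "\<bar>s\<bar> \<le> e * norm (t *\<^sub>R v + s *\<^sub>R n)" for e s t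
  proof -
    have "\<bar>s\<bar> \<le> e * (\<bar>t\<bar> * norm v + \<bar>s\<bar> * norm n)"
      using norm_triangle_ineq[of "t *\<^sub>R v" "s *\<^sub>R n"] that(1)
      by (intro order_trans[OF that(3)] mult_left_mono) auto
    also have "\<dots> \<le> e * (\<bar>t\<bar> * norm v) + \<bar>s\<bar> * (1/2)"
      using mult_left_mono[OF that(2), of "\<bar>s\<bar>"] by (simp add: algebra_simps)
    finally show ?thesis by simp
  qed
  \<comment> \<open>Two demands on the accuracy: \<open>e0 * norm n \<le> 1/2\<close> permits the
    absorption, and \<open>e0 \<le> 1/2\<close> bounds the error at
    \<open>s = \<plusminus>\<delta>\<close> and gives the bound
    \<open>\<bar>t\<bar> * norm v\<close> for \<open>s t\<close>. The 1 in the denominator covers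
    small \<open>n\<close>.\<close>
  define e0 where "e0 = 1 / (2 * (norm n + 1))"
  have pos: "norm n + 1 > 0"
    by (simp add: add_nonneg_pos)
  have e0: "e0 > 0" "e0 * norm n \<le> 1/2" "e0 \<le> 1/2"
    using pos by (auto simp: e0_def divide_simps)
  obtain d1 where d1: "d1 > 0" "\<And>y. norm y < d1 \<Longrightarrow> \<bar>w (x + y) - w' y\<bar> \<le> e0 * norm y"
    using approx[OF e0(1)] by blast
  obtain d2 where d2: "d2 > 0" "ball x d2 \<subseteq> W"
    using W open_contains_ball by blast
  define d0 where "d0 = min d1 d2"
  \<comment> \<open>Chosen so that displacements with both coefficients controlled by \<delta> have
    length at most \<open>d0 / 2\<close>.\<close>
  define \<delta> where "\<delta> = d0 / (2 * (norm n + 1))"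
  have d0: "d0 > 0" using d1 d2 by (simp add: d0_def)
  have "\<delta> * (norm n + 1) = d0 / 2"
    unfolding \<delta>_def using pos by (simp add: divide_simps)
  then have \<delta>: "\<delta> > 0" "\<delta> * norm n + \<delta> = d0 / 2"
    using d0 pos by (simp add: \<delta>_def, simp add: distrib_left)
  have inW: "x + y \<in> W" if "norm y < d0" for y
    using that d2 by (auto simp: d0_def dist_norm subset_iff)
  have bnd: "norm (t *\<^sub>R v + s *\<^sub>R n) < d0" if "\<bar>t\<bar> * norm v < \<delta>" "\<bar>s\<bar> \<le> \<delta>" for t s
  proof -
    have "norm (t *\<^sub>R v + s *\<^sub>R n) \<le> \<bar>t\<bar> * norm v + \<bar>s\<bar> * norm n"
      using norm_triangle_ineq[of "t *\<^sub>R v" "s *\<^sub>R n"] by simp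
    also have "\<dots> \<le> \<delta> + \<delta> * norm n"
      using that by (intro add_mono mult_right_mono) auto
    finally show ?thesis
      using \<delta>(2) d0 by simp
  qed
  have ex: "\<exists>s. \<bar>s\<bar> \<le> \<delta> \<and> w (x + (t *\<^sub>R v + s *\<^sub>R n)) = 0" if t: "\<bar>t\<bar> * norm v < \<delta>" for t
  proof -
    let ?f = "\<lambda>s. w (x + (t *\<^sub>R v + s *\<^sub>R n))"
    \<comment> \<open>The linear part of \<open>?f\<close> is \<open>s\<close> itself, so an error
      below \<delta> at \<open>s = \<plusminus>\<delta>\<close> gives the sign change for the
      intermediate value theorem.\<close>
    have err: "\<bar>?f s - s\<bar> < \<delta>" if "\<bar>s\<bar> = \<delta>" for s
    proof -
      have "\<bar>?f s - s\<bar> \<le> e0 * norm (t *\<^sub>R v + s *\<^sub>R n)"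
        using d1(2)[of "t *\<^sub>R v + s *\<^sub>R n"] bnd[of t s] t that w'_eq[of t s] by (simp add: d0_def)
      also have "\<dots> \<le> e0 * (\<bar>t\<bar> * norm v + \<delta> * norm n)"
        using norm_triangle_ineq[of "t *\<^sub>R v" "s *\<^sub>R n"] that e0 by (intro mult_left_mono) auto
      also have "\<dots> = e0 * (\<bar>t\<bar> * norm v) + \<delta> * (e0 * norm n)"
        by (simp add: algebra_simps)
      also have "\<dots> \<le> 1/2 * (\<bar>t\<bar> * norm v) + \<delta> * (1/2)"
        using e0 \<delta> by (intro add_mono mult_right_mono mult_left_mono) auto
      also have "\<dots> < \<delta>"
        using t by simp
      finally show ?thesis .
    qed
    have "continuous_on {- \<delta>..\<delta>} ?f"
      by (rule continuous_on_compose2[OF W(3)])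
        (use bnd t inW in \<open>auto intro!: continuous_intros\<close>)
    moreover have "?f (- \<delta>) \<le> 0" "0 \<le> ?f \<delta>"
      using err[of \<delta>] err[of "- \<delta>"] \<delta>(1) by (auto simp: abs_if split: if_splits)
    ultimately show ?thesis
      using IVT'[of ?f "- \<delta>" 0 \<delta>] \<delta>(1) by (auto simp: abs_le_iff)
  qed
  define s where "s t = (SOME s. \<bar>s\<bar> \<le> \<delta> \<and> w (x + (t *\<^sub>R v + s *\<^sub>R n)) = 0)" for t
  have s: "\<bar>s t\<bar> \<le> \<delta>" "w (x + (t *\<^sub>R v + s t *\<^sub>R n)) = 0" if "\<bar>t\<bar> * norm v < \<delta>" for t
    using someI_ex[OF ex[OF that]] unfolding s_def by blast+
  have s_bound: "\<bar>s t\<bar> \<le> \<bar>t\<bar> * norm v" if "\<bar>t\<bar> * norm v < \<delta>" for t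
  proof -
    have "\<bar>s t\<bar> \<le> e0 * norm (t *\<^sub>R v + s t *\<^sub>R n)"
      using d1(2)[of "t *\<^sub>R v + s t *\<^sub>R n"] bnd[OF that s(1)[OF that]] s(2)[OF that] w'_eq[of t "s t"] by (simp add: d0_def)
    then have "\<bar>s t\<bar> \<le> 2 * e0 * \<bar>t\<bar> * norm v"
      using small[OF e0(1,2)] by blast
    also have "\<dots> \<le> 1 * (\<bar>t\<bar> * norm v)"
      unfolding mult.assoc[of _ "\<bar>t\<bar>"] using e0(3) by (intro mult_right_mono) auto
    finally show ?thesis by simp
  qed
  define \<gamma> where "\<gamma> t = x + (t *\<^sub>R v + s t *\<^sub>R n)" for t
  \<comment> \<open>At \<open>t = 0\<close> the bound on \<open>s t\<close> reads
    \<open>s 0 = 0\<close>.\<close>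
  have \<gamma>0: "\<gamma> 0 = x"
    using s_bound[of 0] \<delta> by (simp add: \<gamma>_def)
  define T where "T = \<delta> / (norm v + 1)"
  have v1: "norm v + 1 > 0"
    by (simp add: add_nonneg_pos)
  have T: "T > 0" using \<delta> v1 by (simp add: T_def)
  have tT: "\<bar>t\<bar> * norm v < \<delta>" if "\<bar>t\<bar> < T" for t
  proof -
    have "\<bar>t\<bar> * norm v \<le> \<bar>t\<bar> * (norm v + 1)"
      by (intro mult_left_mono) auto
    also have "\<dots> < \<delta>"
      using that v1 by (simp add: T_def field_simps)
    finally show ?thesis .
  qed
  have ev: "\<forall>\<^sub>F t in at 0. \<gamma> t \<in> W \<and> w (\<gamma> t) = 0"
    unfolding eventually_at
    by (rule exI[of _ T]) (use T tT s bnd inW in \<open>auto simp: \<gamma>_def\<close>)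
  have "(\<gamma> has_derivative (\<lambda>h. h *\<^sub>R v)) (at 0)"
    unfolding has_derivative_at_alt
  proof (intro conjI allI impI)
    show "bounded_linear (\<lambda>h. h *\<^sub>R v)"
      by (rule bounded_linear_scaleR_left)
    fix e :: real assume e: "e > 0"
    \<comment> \<open>The second entry makes \<open>2 * e1 * norm v * norm n \<le> e\<close>, which
      is the error allowed to the transversal displacement per unit of \<open>t\<close>.\<close>
    define e1 where "e1 = min e0 (e / (2 * (norm v * norm n + 1)))"
    have vn: "norm v * norm n + 1 > 0"
      by (simp add: add_nonneg_pos)
    have e1: "e1 > 0" "e1 \<le> e0" "e1 \<le> e / (2 * (norm v * norm n + 1))"
      using e0 e vn by (auto simp: e1_def)
    have e1n: "e1 * norm n \<le> 1/2"
      using mult_right_mono[OF e1(2), of "norm n"] e0 by simp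
    have "e1 * (2 * (norm v * norm n + 1)) \<le> e"
      using e1(3) vn by (simp add: field_simps)
    then have e1e: "2 * e1 * norm v * norm n \<le> e"
      using e1(1) by (simp add: algebra_simps)
    obtain d where d: "d > 0" "\<And>y. norm y < d \<Longrightarrow> \<bar>w (x + y) - w' y\<bar> \<le> e1 * norm y"
      using approx[OF e1(1)] by blast
    define k where "k = norm v * (1 + norm n) + 1"
    have k: "k > 0" by (simp add: k_def add_nonneg_pos)
    show "\<exists>d>0. \<forall>t. norm (t - 0) < d \<longrightarrow> norm (\<gamma> t - \<gamma> 0 - (t - 0) *\<^sub>R v) \<le> e * norm (t - 0)"
    proof (intro exI[of _ "min T (d / k)"] conjI allI impI)
      show "min T (d / k) > 0" using T d k by simp
      fix t :: real assume "norm (t - 0) < min T (d / k)"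
      then have t: "\<bar>t\<bar> < T" "\<bar>t\<bar> * k < d"
        using k by (auto simp: field_simps)
      note t' = tT[OF t(1)]
      have "norm (t *\<^sub>R v + s t *\<^sub>R n) \<le> \<bar>t\<bar> * norm v + \<bar>s t\<bar> * norm n"
        using norm_triangle_ineq[of "t *\<^sub>R v" "s t *\<^sub>R n"] by simp
      also have "\<dots> \<le> \<bar>t\<bar> * norm v + \<bar>t\<bar> * norm v * norm n"
        using s_bound[OF t'] by (intro add_left_mono mult_right_mono) auto
      also have "\<dots> \<le> \<bar>t\<bar> * k"
        by (simp add: k_def algebra_simps)
      finally have "norm (t *\<^sub>R v + s t *\<^sub>R n) < d"
        using t by simp
      then have "\<bar>s t\<bar> \<le> e1 * norm (t *\<^sub>R v + s t *\<^sub>R n)"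
        using d(2)[of "t *\<^sub>R v + s t *\<^sub>R n"] s(2)[OF t'] w'_eq[of t "s t"] by simp
      then have "\<bar>s t\<bar> \<le> 2 * e1 * \<bar>t\<bar> * norm v"
        using small[OF e1(1) e1n] by blast
      then have "\<bar>s t\<bar> * norm n \<le> 2 * e1 * \<bar>t\<bar> * norm v * norm n"
        by (intro mult_right_mono) auto
      also have "\<dots> = (2 * e1 * norm v * norm n) * \<bar>t\<bar>"
        by simp
      also have "\<dots> \<le> e * \<bar>t\<bar>"
        using e1e by (intro mult_right_mono) auto
      finally show "norm (\<gamma> t - \<gamma> 0 - (t - 0) *\<^sub>R v) \<le> e * norm (t - 0)"
        unfolding \<gamma>0 by (simp add: \<gamma>_def)
    qed
  qed
  then have "(\<gamma> has_vector_derivative v) (at 0)"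
    by (simp add: has_vector_derivative_def)
  then show ?thesis
    using that \<gamma>0 ev by blast
qed

text \<open>A curve in the level set has velocity in the kernel of \<open>w'\<close> by the chain
  rule; conversely the constructed curve realises every kernel vector. Continuity at 0 keeps curves
  in \<open>W\<close>, the only place where \<open>S\<close> is known to be the level set.\<close>

lemma level_set_tangents:
  fixes w :: "'a::euclidean_space \<Rightarrow> real"
  assumes W: "open W" "x \<in> W" "continuous_on W w" and w: "(w has_derivative w') (at x)" "w x = 0" "w' \<noteq> (\<lambda>_. 0)"
    and S: "S \<inter> W = {y \<in> W. w y = 0}"
  shows "{v. \<exists>\<gamma>. \<gamma> 0 = x \<and> (\<gamma> has_vector_derivative v) (at (0::real)) \<and> (\<forall>\<^sub>F t in at 0. \<gamma> t \<in> S)} = {v. w' v = 0}"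
proof (intro equalityI subsetI CollectI; elim CollectE)
  fix v assume "\<exists>\<gamma>. \<gamma> 0 = x \<and> (\<gamma> has_vector_derivative v) (at (0::real)) \<and> (\<forall>\<^sub>F t in at 0. \<gamma> t \<in> S)"
  then obtain \<gamma> where \<gamma>: "\<gamma> 0 = x" "(\<gamma> has_vector_derivative v) (at (0::real))" "\<forall>\<^sub>F t in at 0. \<gamma> t \<in> S"
    by blast
  have "(\<gamma> \<longlongrightarrow> x) (at 0)"
    using has_vector_derivative_continuous[OF \<gamma>(2)] \<gamma>(1) by (simp add: continuous_at)
  then have "\<forall>\<^sub>F t in at 0. \<gamma> t \<in> W"
    using W topological_tendstoD by blast
  with \<gamma>(3) have "\<forall>\<^sub>F t in at 0. w (\<gamma> t) = 0"
    by eventually_elim (use S in blast)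
  then show "w' v = 0"
    using derivative_along_curve_zero[OF w(1) \<gamma>(1,2)] w(2) by blast
next
  fix v assume v: "w' v = 0"
  obtain z where z: "w' z \<noteq> 0" using w(3) by auto
  have "w' (z /\<^sub>R w' z) = 1"
    using z linear_cmul[OF has_derivative_linear[OF w(1)]] by simp
  then obtain \<gamma> where \<gamma>: "\<gamma> 0 = x" "(\<gamma> has_vector_derivative v) (at (0::real))"
    "\<forall>\<^sub>F t in at 0. \<gamma> t \<in> W \<and> w (\<gamma> t) = 0"
    using level_set_curve_exists[OF W w(1,2) _ v] by blast
  have "\<forall>\<^sub>F t in at 0. \<gamma> t \<in> S"
    using \<gamma>(3) by eventually_elim (use S in blast)
  then show "\<exists>\<gamma>. \<gamma> 0 = x \<and> (\<gamma> has_vector_derivative v) (at (0::real)) \<and> (\<forall>\<^sub>F t in at 0. \<gamma> t \<in> S)"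
    using \<gamma> by blast
qed

section \<open>Hypersurfaces in a coordinate chart\<close>

definition pos_def_matrix :: "real^'n^'n::finite \<Rightarrow> bool" where
  "pos_def_matrix M \<longleftrightarrow> transpose M = M \<and> (\<forall>v. v \<noteq> 0 \<longrightarrow> v \<bullet> (M *v v) > 0)"

lemma symmetric_matrix_inner:
  fixes M :: "real^'n^'n::finite"
  assumes "transpose M = M"
  shows "u \<bullet> (M *v v) = (M *v u) \<bullet> v"
  by (metis assms dot_lmul_matrix vector_transpose_matrix)

lemma pos_def_matrix_inner_commute: "pos_def_matrix M \<Longrightarrow> u \<bullet> (M *v v) = v \<bullet> (M *v u)"
  using symmetric_matrix_inner[of M u v] by (simp add: pos_def_matrix_def inner_commute)

lemma pos_def_matrix_invertible:
  assumes "pos_def_matrix M"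
  shows "invertible M"
proof -
  have "x = 0" if "M *v x = 0" for x
    using assms that by (metis inner_zero_right less_irrefl pos_def_matrix_def)
  then show ?thesis
    unfolding invertible_left_inverse matrix_left_invertible_ker by blast
qed

lemma matrix_inv_mult_vec:
  fixes M :: "real^'n^'n::finite"
  assumes "invertible M"
  shows "matrix_inv M *v (M *v v) = v" "M *v (matrix_inv M *v v) = v"
proof -
  have "M ** matrix_inv M = mat 1 \<and> matrix_inv M ** M = mat 1"
    using assms unfolding matrix_inv_def invertible_def by (rule someI_ex)
  then show "matrix_inv M *v (M *v v) = v" "M *v (matrix_inv M *v v) = v"
    by (simp_all add: matrix_vector_mul_assoc)
qed

lemma bounded_linear_matrix_vector_mult_left:
  "bounded_linear (\<lambda>M::real^'n^'m::finite. M *v (v::real^'n::finite))"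
  unfolding linear_conv_bounded_linear[symmetric]
  by (rule linearI) (simp_all add: matrix_vector_mult_add_rdistrib scaleR_matrix_vector_assoc)

text \<open>Cramer's rule writes the solution as a quotient of polynomials in the entries, and
  positive definiteness keeps the denominator away from 0. So the solution inherits C^1 dependence
  on the point.\<close>

lemma Ck_on_1_solve:
  fixes G :: "real^'n \<Rightarrow> real^'n^'n::finite"
  assumes W: "open W" and G: "Ck_on 1 G W" "\<And>y. y \<in> W \<Longrightarrow> pos_def_matrix (G y)"
    and b: "Ck_on 1 b W"
  obtains z where "Ck_on 1 z W" "\<And>y. y \<in> W \<Longrightarrow> G y *v z y = b y"
proof -
  define z where "z y = (\<chi> k. det ((\<chi> i j. if j = k then b y $ i else G y $ i $ j) :: real^'n^'n) / det (G y))" for y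
  have det: "det (G y) \<noteq> 0" if "y \<in> W" for y
    using pos_def_matrix_invertible[OF G(2)[OF that]] invertible_det_nz by blast
  have comp: "Ck_on 1 (\<lambda>y. G y $ i $ j) W" "Ck_on 1 (\<lambda>y. b y $ i) W" for i j
    by (intro Ck_on_vec_nth W G b)+
  have "Ck_on 1 z W"
    unfolding z_def
  proof (intro Ck_on_vec_lambda Ck_on_1_divide Ck_on_det W)
    show "Ck_on 1 (\<lambda>y. (\<chi> i j. if j = k then b y $ i else G y $ i $ j) $ i $ j) W" for k i j
      unfolding vec_lambda_beta by (cases "j = k") (simp_all only: simp_thms if_True if_False comp)
  qed (use comp det in auto)
  moreover have "G y *v z y = b y" if "y \<in> W" for y
    using cramer[OF det[OF that], of "z y" "b y"] by (simp add: z_def)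
  ultimately show ?thesis
    using that by blast
qed

lemma Ck_on_1_gradient:
  assumes "open W" "Ck_on 2 w W"
  shows "Ck_on 1 (gradient w) W"
  unfolding gradient_def[abs_def] partial_def
  using assms by (intro Ck_on_vec_lambda) (simp_all add: numeral_2_eq_2)

text \<open>The field is the Riemannian gradient of \<open>w\<close>, solved from
  \<open>G z = gradient w\<close>, divided by its length \<open>sqrt q\<close>. One derivative of
  \<open>w\<close> is spent, which leaves C^1, matching the metric.\<close>

lemma C1_unit_normal_exists:
  fixes G :: "real^'n \<Rightarrow> real^'n^'n::finite"
  assumes W: "open W" and G: "Ck_on 1 G W" "\<And>y. y \<in> W \<Longrightarrow> pos_def_matrix (G y)"
    and w: "Ck_on 2 w W" "\<And>y. y \<in> W \<Longrightarrow> gradient w y \<noteq> 0"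
  obtains V where "Ck_on 1 V W" "\<And>y. y \<in> W \<Longrightarrow> V y \<bullet> (G y *v V y) = 1"
    "\<And>y v. y \<in> W \<Longrightarrow> gradient w y \<bullet> v = 0 \<Longrightarrow> V y \<bullet> (G y *v v) = 0"
    "\<And>y. y \<in> W \<Longrightarrow> gradient w y \<bullet> V y > 0"
proof -
  have grad: "Ck_on 1 (gradient w) W"
    by (rule Ck_on_1_gradient[OF W w(1)])
  obtain z where z: "Ck_on 1 z W" "\<And>y. y \<in> W \<Longrightarrow> G y *v z y = gradient w y"
    using Ck_on_1_solve[OF W G grad] by blast
  define q where "q y = z y \<bullet> gradient w y" for y
  have q: "q y > 0" if "y \<in> W" for y
  proof -
    have "z y \<noteq> 0"
      using z(2)[OF that] w(2)[OF that] by force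
    then show ?thesis
      using G(2)[OF that] z(2)[OF that] by (auto simp: pos_def_matrix_def q_def)
  qed
  define V where "V y = (1 / sqrt (q y)) *\<^sub>R z y" for y
  have "Ck_on 1 q W"
    unfolding q_def[abs_def] by (intro Ck_on_bilinear[OF bounded_bilinear_inner] W z grad)
  then have "Ck_on 1 V W"
    unfolding V_def[abs_def] using q
    by (intro Ck_on_scaleR Ck_on_1_divide Ck_on_1_sqrt W z Ck_on_const) force+
  moreover have "V y \<bullet> (G y *v V y) = 1" if "y \<in> W" for y
    using q[OF that] z(2)[OF that]
    by (simp add: V_def matrix_vector_mult_scaleR flip: q_def)
  moreover have "V y \<bullet> (G y *v v) = 0" if "y \<in> W" "gradient w y \<bullet> v = 0" for y v
    using symmetric_matrix_inner[of "G y" "z y" v] G(2)[OF that(1)] z(2)[OF that(1)] that(2)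
    by (simp add: V_def pos_def_matrix_def)
  moreover have "gradient w y \<bullet> V y > 0" if "y \<in> W" for y
    using q[OF that] by (simp add: V_def q_def inner_commute)
  ultimately show ?thesis
    using that by blast
qed

text \<open>The part of \<open>b\<close> orthogonal to \<open>a\<close> is also orthogonal to
  \<open>b\<close>, hence zero, and pairing with \<open>V\<close> finds the factor. With
  \<open>a\<close> the gradient and \<open>b = G V\<close> this says that the differential is a
  multiple of the inner product with the normal.\<close>

lemma gradient_eq_normal:
  fixes a b V :: "'a::real_inner"
  assumes "a \<noteq> 0" "V \<bullet> b = 1" "\<And>v. a \<bullet> v = 0 \<Longrightarrow> b \<bullet> v = 0"
  shows "(a \<bullet> V) *\<^sub>R b = a"
proof -
  define k where "k = (a \<bullet> b) / (a \<bullet> a)"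
  let ?v = "b - k *\<^sub>R a"
  have av: "a \<bullet> ?v = 0"
    using assms(1) by (simp add: k_def inner_diff_right)
  then have "?v \<bullet> ?v = 0"
    using assms(3)[OF av] by (simp add: inner_diff_left)
  then have b: "b = k *\<^sub>R a"
    by simp
  then have "k * (a \<bullet> V) = 1"
    using assms(2) by (simp add: inner_commute)
  then show ?thesis
    by (subst b) (simp add: mult.commute)
qed

section \<open>The Levi-Civita connection in coordinates, with its symbols contracted to a bilinear
  map\<close>

definition christoffel_vec :: "(real^'n \<Rightarrow> real^'n^'n) \<Rightarrow> real^'n \<Rightarrow> real^'n \<Rightarrow> real^'n \<Rightarrow> real^'n::finite" where
  "christoffel_vec G x u v = (\<chi> k. \<Sum>i\<in>UNIV. \<Sum>j\<in>UNIV. christoffel G x k i j * u $ i * v $ j)"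

lemma covariant_deriv_eq:
  "covariant_deriv G x u V = frechet_derivative V (at x) u + christoffel_vec G x u (V x)"
  by (simp add: covariant_deriv_def christoffel_vec_def vec_eq_iff)

lemma bilinear_christoffel_vec: "bilinear (christoffel_vec G x)"
  unfolding bilinear_def
  by (auto intro!: linearI simp: christoffel_vec_def vec_eq_iff sum_distrib_left sum.distrib algebra_simps)

lemma trilinear_derivative_expansion:
  fixes G :: "real^'n \<Rightarrow> real^'n^'n::finite"
  assumes "G differentiable (at x)"
  shows "v \<bullet> (frechet_derivative G (at x) u *v z) =
    (\<Sum>i\<in>UNIV. \<Sum>j\<in>UNIV. \<Sum>l\<in>UNIV. partial i (\<lambda>y. G y $ j $ l) x * u $ i * v $ j * z $ l)"
proof -
  have part: "partial i (\<lambda>y. G y $ j $ l) x = frechet_derivative G (at x) (axis i 1) $ j $ l" for i j l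
  proof -
    have "((\<lambda>y. G y $ j $ l) has_derivative (\<lambda>u. frechet_derivative G (at x) u $ j $ l)) (at x)"
      using assms unfolding frechet_derivative_works
      by (rule bounded_linear.has_derivative[OF bounded_linear_compose[OF bounded_linear_vec_nth bounded_linear_vec_nth]])
    from frechet_derivative_at[OF this] show ?thesis
      by (simp add: partial_def fun_eq_iff)
  qed
  have "v \<bullet> (frechet_derivative G (at x) u *v z) =
     (\<Sum>i\<in>UNIV. u $ i * (v \<bullet> (frechet_derivative G (at x) (axis i 1) *v z)))"
    unfolding frechet_derivative_axis_expansion[OF assms, of u]
    by (simp add: linear_sum[OF bounded_linear.linear[OF bounded_linear_matrix_vector_mult_left]]
        inner_sum_right scaleR_matrix_vector_assoc[symmetric])
  also have "\<dots> = (\<Sum>i\<in>UNIV. \<Sum>j\<in>UNIV. \<Sum>l\<in>UNIV. partial i (\<lambda>y. G y $ j $ l) x * u $ i * v $ j * z $ l)"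
    unfolding part
    by (simp add: inner_vec_def matrix_vector_mult_def sum_distrib_left mult_ac)
  finally show ?thesis .
qed

text \<open>Pairing with \<open>G z\<close> cancels the inverse matrix in the Christoffel symbols.
  What remains is a reordering of sums that turns each family of partial derivatives into a
  directional derivative of \<open>G\<close>.\<close>

lemma koszul_formula:
  fixes G :: "real^'n \<Rightarrow> real^'n^'n::finite"
  assumes G: "G differentiable (at x)" "pos_def_matrix (G x)"
  shows "(G x *v z) \<bullet> christoffel_vec G x u v =
    (v \<bullet> (frechet_derivative G (at x) u *v z) + u \<bullet> (frechet_derivative G (at x) v *v z)
      - u \<bullet> (frechet_derivative G (at x) z *v v)) / 2"
proof -
  define C where "C i j l = partial i (\<lambda>y. G y $ j $ l) x + partial j (\<lambda>y. G y $ i $ l) x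
        - partial l (\<lambda>y. G y $ i $ j) x" for i j l
  define c where "c = (\<chi> l. \<Sum>i\<in>UNIV. \<Sum>j\<in>UNIV. C i j l * u $ i * v $ j)"
  have "christoffel_vec G x u v = (1/2) *\<^sub>R (matrix_inv (G x) *v c)"
  proof -
    have "(\<Sum>i\<in>UNIV. \<Sum>j\<in>UNIV. christoffel G x k i j * u $ i * v $ j) =
      (\<Sum>i\<in>UNIV. \<Sum>j\<in>UNIV. \<Sum>l\<in>UNIV. (1/2) * (matrix_inv (G x) $ k $ l * (C i j l * u $ i * v $ j)))" for k
      by (simp add: christoffel_def C_def sum_distrib_left sum_distrib_right mult.assoc)
    also have "\<dots> k = (\<Sum>i\<in>UNIV. \<Sum>l\<in>UNIV. \<Sum>j\<in>UNIV. (1/2) * (matrix_inv (G x) $ k $ l * (C i j l * u $ i * v $ j)))" for k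
      by (rule sum.cong[OF refl], rule sum.swap)
    also have "\<dots> k = (\<Sum>l\<in>UNIV. \<Sum>i\<in>UNIV. \<Sum>j\<in>UNIV. (1/2) * (matrix_inv (G x) $ k $ l * (C i j l * u $ i * v $ j)))" for k
      by (rule sum.swap)
    finally show ?thesis
      by (simp add: christoffel_vec_def vec_eq_iff matrix_vector_mult_def c_def sum_distrib_left)
  qed
  then have "(G x *v z) \<bullet> christoffel_vec G x u v = (z \<bullet> c) / 2"
    using symmetric_matrix_inner[of "G x" z "matrix_inv (G x) *v c"] G(2)
    by (simp add: matrix_inv_mult_vec[OF pos_def_matrix_invertible] pos_def_matrix_def)
  also have "z \<bullet> c = (\<Sum>l\<in>UNIV. \<Sum>i\<in>UNIV. \<Sum>j\<in>UNIV. C i j l * u $ i * v $ j * z $ l)"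
    by (simp add: inner_vec_def c_def sum_distrib_left sum_distrib_right mult_ac)
  also have "\<dots> = (\<Sum>i\<in>UNIV. \<Sum>l\<in>UNIV. \<Sum>j\<in>UNIV. C i j l * u $ i * v $ j * z $ l)"
    by (rule sum.swap)
  also have "\<dots> = (\<Sum>i\<in>UNIV. \<Sum>j\<in>UNIV. \<Sum>l\<in>UNIV. C i j l * u $ i * v $ j * z $ l)"
    by (rule sum.cong[OF refl], rule sum.swap)
  also have "\<dots> = (\<Sum>i\<in>UNIV. \<Sum>j\<in>UNIV. \<Sum>l\<in>UNIV. partial i (\<lambda>y. G y $ j $ l) x * u $ i * v $ j * z $ l)
      + (\<Sum>i\<in>UNIV. \<Sum>j\<in>UNIV. \<Sum>l\<in>UNIV. partial j (\<lambda>y. G y $ i $ l) x * u $ i * v $ j * z $ l)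
      - (\<Sum>i\<in>UNIV. \<Sum>j\<in>UNIV. \<Sum>l\<in>UNIV. partial l (\<lambda>y. G y $ i $ j) x * u $ i * v $ j * z $ l)"
    by (simp add: C_def algebra_simps sum.distrib sum_subtractf)
  also have "(\<Sum>i\<in>UNIV. \<Sum>j\<in>UNIV. \<Sum>l\<in>UNIV. partial j (\<lambda>y. G y $ i $ l) x * u $ i * v $ j * z $ l)
      = (\<Sum>j\<in>UNIV. \<Sum>i\<in>UNIV. \<Sum>l\<in>UNIV. partial j (\<lambda>y. G y $ i $ l) x * v $ j * u $ i * z $ l)"
    by (subst sum.swap) (simp add: mult_ac)
  also have "(\<Sum>i\<in>UNIV. \<Sum>j\<in>UNIV. \<Sum>l\<in>UNIV. partial l (\<lambda>y. G y $ i $ j) x * u $ i * v $ j * z $ l)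
      = (\<Sum>i\<in>UNIV. \<Sum>l\<in>UNIV. \<Sum>j\<in>UNIV. partial l (\<lambda>y. G y $ i $ j) x * u $ i * v $ j * z $ l)"
    by (rule sum.cong[OF refl], rule sum.swap)
  also have "\<dots> = (\<Sum>l\<in>UNIV. \<Sum>i\<in>UNIV. \<Sum>j\<in>UNIV. partial l (\<lambda>y. G y $ i $ j) x * z $ l * u $ i * v $ j)"
    by (subst sum.swap) (simp add: mult_ac)
  finally show ?thesis
    by (simp only: trilinear_derivative_expansion[OF G(1)])
qed

lemma frechet_derivative_symmetric_matrix:
  fixes G :: "real^'n \<Rightarrow> real^'n^'n::finite"
  assumes "open W" "x \<in> W" "\<And>y. y \<in> W \<Longrightarrow> transpose (G y) = G y" "G differentiable (at x)"
  shows "transpose (frechet_derivative G (at x) u) = frechet_derivative G (at x) u"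
proof -
  have "linear (transpose :: real^'n^'n \<Rightarrow> real^'n^'n)"
    by (rule linearI) (simp_all add: transpose_def vec_eq_iff)
  then have "bounded_linear (transpose :: real^'n^'n \<Rightarrow> real^'n^'n)"
    by (simp add: linear_conv_bounded_linear)
  then have "((\<lambda>y. transpose (G y)) has_derivative (\<lambda>u. transpose (frechet_derivative G (at x) u))) (at x)"
    by (rule bounded_linear.has_derivative) (use assms(4) in \<open>simp add: frechet_derivative_works\<close>)
  then have "(G has_derivative (\<lambda>u. transpose (frechet_derivative G (at x) u))) (at x)"
    by (rule has_derivative_transform_within_open) (use assms in auto)
  from fun_cong[OF frechet_derivative_at[OF this, symmetric], of u] show ?thesis
    by simp
qed

text \<open>The connection is torsion free: the right-hand side of \<open>koszul_formula\<close> is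
  symmetric in \<open>u\<close> and \<open>v\<close>. Pairing the difference \<open>?d\<close> with
  the preimage \<open>?z\<close> of \<open>?d\<close> under \<open>G x\<close> gives
  \<open>?d \<bullet> ?d = 0\<close>.\<close>

lemma christoffel_vec_commute:
  fixes G :: "real^'n \<Rightarrow> real^'n^'n::finite"
  assumes "open W" "x \<in> W" "\<And>y. y \<in> W \<Longrightarrow> pos_def_matrix (G y)" "G differentiable (at x)"
  shows "christoffel_vec G x u v = christoffel_vec G x v u"
proof -
  let ?d = "christoffel_vec G x u v - christoffel_vec G x v u"
  let ?z = "matrix_inv (G x) *v ?d"
  note sym = frechet_derivative_symmetric_matrix[OF assms(1,2) _ assms(4)]
  have "u \<bullet> (frechet_derivative G (at x) z *v v) = v \<bullet> (frechet_derivative G (at x) z *v u)" for z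
    using symmetric_matrix_inner[OF sym, of u z v] assms(3) by (simp add: pos_def_matrix_def inner_commute)
  then have "(G x *v z) \<bullet> ?d = 0" for z
    using koszul_formula[OF assms(4) assms(3)[OF assms(2)], of z u v]
      koszul_formula[OF assms(4) assms(3)[OF assms(2)], of z v u]
    by (simp add: inner_diff_right)
  from this[of ?z] have "?d \<bullet> ?d = 0"
    by (simp add: matrix_inv_mult_vec[OF pos_def_matrix_invertible] assms)
  then show ?thesis by simp
qed

text \<open>The metric is parallel. Of the two Koszul formulas added here, the derivatives along
  \<open>v\<close> and \<open>V\<close> cancel by symmetry of the matrix derivative, and the two
  halves along \<open>u\<close> add up.\<close>

lemma metric_compatible:
  fixes G :: "real^'n \<Rightarrow> real^'n^'n::finite"
  assumes "open W" "x \<in> W" "\<And>y. y \<in> W \<Longrightarrow> pos_def_matrix (G y)" "G differentiable (at x)"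
  shows "V \<bullet> (frechet_derivative G (at x) u *v v) =
    (G x *v V) \<bullet> christoffel_vec G x u v + (G x *v v) \<bullet> christoffel_vec G x u V"
proof -
  note sym = frechet_derivative_symmetric_matrix[OF assms(1,2) _ assms(4)]
  have swap: "a \<bullet> (frechet_derivative G (at x) z *v b) = b \<bullet> (frechet_derivative G (at x) z *v a)" for a b z
    using symmetric_matrix_inner[OF sym, of a z b] assms(3) by (simp add: pos_def_matrix_def inner_commute)
  show ?thesis
    unfolding koszul_formula[OF assms(4) assms(3)[OF assms(2)]]
    using swap[of v u V] swap[of u v V] swap[of u V v] by (simp add: field_simps)
qed

section \<open>The Hessian as a bilinear form, and its value on tangent vectors of a level
  set\<close>

definition hess_form :: "(real^'n \<Rightarrow> real^'n^'n) \<Rightarrow> (real^'n \<Rightarrow> real) \<Rightarrow> real^'n \<Rightarrow> real^'n::finite \<Rightarrow> real^'n \<Rightarrow> real" where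
  "hess_form G F x u v = frechet_derivative (\<lambda>y. frechet_derivative F (at y) v) (at x) u
     - frechet_derivative F (at x) (christoffel_vec G x u v)"

lemma second_derivative_expansion:
  fixes F :: "real^'n::finite \<Rightarrow> real"
  assumes F: "Ck_on 2 F W" "open W" "x \<in> W"
  shows "frechet_derivative (\<lambda>y. frechet_derivative F (at y) v) (at x) u =
    (\<Sum>i\<in>UNIV. \<Sum>j\<in>UNIV. partial i (partial j F) x * u $ i * v $ j)"
proof -
  have Fd: "F differentiable (at y)" if "y \<in> W" for y
    using F that by (simp add: numeral_2_eq_2)
  have "Ck_on 1 (partial j F) W" for j
    using F by (simp add: numeral_2_eq_2 partial_def[abs_def])
  from Ck_on_has_derivative[OF this[unfolded One_nat_def] F(3)]
  have d: "(partial j F has_derivative frechet_derivative (partial j F) (at x)) (at x)" for j .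
  have "((\<lambda>y. \<Sum>j\<in>UNIV. v $ j * partial j F y) has_derivative
      (\<lambda>u. \<Sum>j\<in>UNIV. v $ j * frechet_derivative (partial j F) (at x) u)) (at x)"
    by (rule has_derivative_sum, rule has_derivative_mult_right, rule d)
  moreover have "(\<Sum>j\<in>UNIV. v $ j * partial j F y) = frechet_derivative F (at y) v" if "y \<in> W" for y
    using frechet_derivative_axis_expansion[OF Fd[OF that], of v] by (simp add: partial_def)
  ultimately have "((\<lambda>y. frechet_derivative F (at y) v) has_derivative
      (\<lambda>u. \<Sum>j\<in>UNIV. v $ j * frechet_derivative (partial j F) (at x) u)) (at x)"
    by (rule has_derivative_transform_within_open[OF _ F(2,3)])
  from fun_cong[OF frechet_derivative_at[OF this, symmetric], of u]
  have "frechet_derivative (\<lambda>y. frechet_derivative F (at y) v) (at x) u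
     = (\<Sum>j\<in>UNIV. v $ j * frechet_derivative (partial j F) (at x) u)" .
  also have "\<dots> = (\<Sum>j\<in>UNIV. \<Sum>i\<in>UNIV. partial i (partial j F) x * u $ i * v $ j)"
  proof -
    have "frechet_derivative (partial j F) (at x) u = (\<Sum>i\<in>UNIV. u $ i * partial i (partial j F) x)" for j
      using frechet_derivative_axis_expansion[OF differentiableI[OF d[of j]], of u]
      by (simp add: partial_def[where F = "partial j F"])
    then show ?thesis
      by (simp add: sum_distrib_left mult_ac)
  qed
  finally show ?thesis
    by (subst sum.swap)
qed

lemma sum_hessian_coeff:
  fixes F :: "real^'n::finite \<Rightarrow> real"
  assumes F: "Ck_on 2 F W" "open W" "x \<in> W"
  shows "(\<Sum>i\<in>UNIV. \<Sum>j\<in>UNIV. hessian_coeff G F x i j * u $ i * v $ j) = hess_form G F x u v"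
proof -
  have "F differentiable (at x)"
    using F by (simp add: numeral_2_eq_2)
  then have "frechet_derivative F (at x) (christoffel_vec G x u v) =
     (\<Sum>k\<in>UNIV. \<Sum>i\<in>UNIV. \<Sum>j\<in>UNIV. christoffel G x k i j * partial k F x * u $ i * v $ j)"
    by (subst frechet_derivative_axis_expansion)
      (simp_all add: christoffel_vec_def partial_def sum_distrib_left sum_distrib_right mult_ac)
  also have "\<dots> = (\<Sum>i\<in>UNIV. \<Sum>k\<in>UNIV. \<Sum>j\<in>UNIV. christoffel G x k i j * partial k F x * u $ i * v $ j)"
    by (rule sum.swap)
  also have "\<dots> = (\<Sum>i\<in>UNIV. \<Sum>j\<in>UNIV. \<Sum>k\<in>UNIV. christoffel G x k i j * partial k F x * u $ i * v $ j)"
    by (rule sum.cong[OF refl], rule sum.swap)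
  finally show ?thesis
    unfolding hess_form_def second_derivative_expansion[OF F]
    by (simp add: hessian_coeff_def left_diff_distrib sum_subtractf sum_distrib_right)
qed

lemma hess_form_commute:
  fixes G :: "real^'n \<Rightarrow> real^'n^'n::finite"
  assumes "open W" "x \<in> W" "\<And>y. y \<in> W \<Longrightarrow> pos_def_matrix (G y)" "G differentiable (at x)" "Ck_on 2 F W"
  shows "hess_form G F x u v = hess_form G F x v u"
  using Ck_on_2_frechet_derivative_commute[OF assms(5,1,2)] christoffel_vec_commute[OF assms(1-4), of u v]
  by (simp add: hess_form_def)

lemma bilinear_hess_form:
  fixes F :: "real^'n::finite \<Rightarrow> real"
  assumes F: "Ck_on 2 F W" "open W" "x \<in> W"
  shows "bilinear (hess_form G F x)"
  unfolding bilinear_def sum_hessian_coeff[OF F, symmetric]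
  by (auto intro!: linearI simp: sum_distrib_left sum.distrib algebra_simps)

text \<open>Differentiating the identity \<open>grad w = dw(V) G V\<close> along the level set and using metric
  compatibility.\<close>

lemma hess_form_eq_covariant_deriv:
  fixes G :: "real^'n \<Rightarrow> real^'n^'n::finite" and V :: "real^'n \<Rightarrow> real^'n"
  assumes W: "open W" "x \<in> W" and w: "Ck_on 2 w W"
    and G: "\<And>y. y \<in> W \<Longrightarrow> pos_def_matrix (G y)" "G differentiable (at x)"
    and V: "V differentiable (at x)"
    and normal: "\<And>y. y \<in> W \<Longrightarrow> w y = 0 \<Longrightarrow> (gradient w y \<bullet> V y) *\<^sub>R (G y *v V y) = gradient w y"
    and x: "w x = 0"
    and u: "gradient w x \<bullet> u = 0" and v: "gradient w x \<bullet> v = 0" and nz: "gradient w x \<noteq> 0"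
  shows "hess_form G w x u v = (gradient w x \<bullet> V x) * (covariant_deriv G x u V \<bullet> (G x *v v))"
proof -
  have wd: "w differentiable (at y)" if "y \<in> W" for y
    using w that by (simp add: numeral_2_eq_2)
  let ?s = "\<lambda>y. gradient w y \<bullet> V y"
  let ?dG = "frechet_derivative G (at x)" and ?dV = "frechet_derivative V (at x)"
  let ?D = "frechet_derivative (\<lambda>y. frechet_derivative w (at y) v) (at x)"
  \<comment> \<open>For the unit normal \<open>V\<close> this function vanishes on the level set, so
    its derivative in the tangent direction \<open>u\<close> is 0.\<close>
  let ?P = "\<lambda>y. ?s y * (V y \<bullet> (G y *v v)) - frechet_derivative w (at y) v"
  have Vd: "(V has_derivative ?dV) (at x)" and Gd: "(G has_derivative ?dG) (at x)"
    using V G(2) by (simp_all add: frechet_derivative_works)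
  have dd: "((\<lambda>y. frechet_derivative w (at y) v) has_derivative ?D) (at x)"
    using w W by (auto simp: numeral_2_eq_2 frechet_derivative_works[symmetric])
  from Ck_on_has_derivative[OF Ck_on_1_gradient[OF W(1) w, unfolded One_nat_def] W(2)]
  have gd: "(gradient w has_derivative frechet_derivative (gradient w) (at x)) (at x)" .
  obtain s' where sd: "(?s has_derivative s') (at x)"
    using has_derivative_inner[OF gd Vd] by blast
  have Pd: "(?P has_derivative
     (\<lambda>h. (?s x * (V x \<bullet> (?dG h *v v) + ?dV h \<bullet> (G x *v v)) + s' h * (V x \<bullet> (G x *v v))) - ?D h)) (at x)"
    by (intro has_derivative_diff has_derivative_mult has_derivative_inner Vd sd dd
        bounded_linear.has_derivative[OF bounded_linear_matrix_vector_mult_left] Gd)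
  have P0: "?P y = 0" if "y \<in> W" "w y = 0" for y
  proof -
    have "frechet_derivative w (at y) v = (?s y *\<^sub>R (G y *v V y)) \<bullet> v"
      using gradient_inner[OF wd[OF that(1)], of v] normal[OF that] by simp
    then show ?thesis
      using symmetric_matrix_inner[of "G y" "V y" v] G(1)[OF that(1)] by (simp add: pos_def_matrix_def)
  qed
  have wx: "(w has_derivative (\<lambda>h. gradient w x \<bullet> h)) (at x)"
    using wd[OF W(2)] gradient_inner[OF wd[OF W(2)]] by (simp add: frechet_derivative_works)
  have cont: "continuous_on W w"
    using wd by (meson continuous_at_imp_continuous_on differentiable_imp_continuous_within)
  obtain \<gamma> where \<gamma>: "\<gamma> 0 = x" "(\<gamma> has_vector_derivative u) (at (0::real))" "\<forall>\<^sub>F t in at 0. \<gamma> t \<in> W \<and> w (\<gamma> t) = 0"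
    using level_set_curve_exists[OF W cont wx x _ u, of "gradient w x /\<^sub>R (gradient w x \<bullet> gradient w x)"] nz by auto
  have "?s x * (V x \<bullet> (?dG u *v v) + ?dV u \<bullet> (G x *v v)) + s' u * (V x \<bullet> (G x *v v)) - ?D u = 0"
    by (rule derivative_along_curve_zero[OF Pd \<gamma>(1,2)])
      (use \<gamma>(3) P0 W x in \<open>auto elim!: eventually_mono\<close>)
  \<comment> \<open>The derivative \<open>s'\<close> of the scalar factor enters multiplied by the
    inner product of \<open>V x\<close> and \<open>v\<close>, which is 0 for tangent
    \<open>v\<close>.\<close>
  moreover have Gv: "?s x *\<^sub>R (G x *v V x) = gradient w x"
    by (rule normal[OF W(2) x])
  then have "?s x * (V x \<bullet> (G x *v v)) = 0"
    using v symmetric_matrix_inner[of "G x" "V x" v] G(1)[OF W(2)]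
    by (metis inner_scaleR_left pos_def_matrix_def)
  moreover have "?s x \<noteq> 0"
    using Gv nz by force
  ultimately have D: "?D u = ?s x * (V x \<bullet> (?dG u *v v) + ?dV u \<bullet> (G x *v v))"
    by simp
  have "frechet_derivative w (at x) (christoffel_vec G x u v) = ?s x * ((G x *v V x) \<bullet> christoffel_vec G x u v)"
    using gradient_inner[OF wd[OF W(2)], of "christoffel_vec G x u v"] Gv by (metis inner_scaleR_left)
  \<comment> \<open>The first summand cancels the Christoffel term of the Hessian; the second
    completes the derivative of \<open>V\<close> to the covariant derivative.\<close>
  moreover have "V x \<bullet> (?dG u *v v) = (G x *v V x) \<bullet> christoffel_vec G x u v + (G x *v v) \<bullet> christoffel_vec G x u (V x)"
    by (rule metric_compatible[OF W G])
  ultimately show ?thesis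
    unfolding hess_form_def D covariant_deriv_eq inner_add_left
    by (simp add: inner_commute distrib_left)
qed

section \<open>Test functions: a compactly supported factor with prescribed value and differential
  at one point\<close>

lemma C2_bump_exists:
  fixes L :: "'a::euclidean_space \<Rightarrow> real" and x :: 'a
  assumes L: "linear L" and r: "r > 0"
  obtains \<phi> where "Ck_on 2 \<phi> UNIV" "\<And>y. \<phi> y \<le> 0" "\<phi> x = -1" "(\<phi> has_derivative L) (at x)"
    "\<And>y. r \<le> dist x y \<Longrightarrow> \<phi> y = 0"
proof -
  have bl: "bounded_linear L"
    using L by (simp add: linear_conv_bounded_linear)
  obtain K where K: "K > 0" "\<And>z. \<bar>L z\<bar> \<le> norm z * K"
    using bounded_linear.pos_bounded[OF bl] by auto
  \<comment> \<open>Outside the ball, \<open>1 / r\<^sup>2\<close> makes the quadratic term beat the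
    constant 1 and \<open>K / (3 * r)\<close> makes it beat the linear term, so
    \<open>q \<le> 0\<close> there.\<close>
  define C where "C = 1 / r\<^sup>2 + K / (3 * r)"
  \<comment> \<open>The coefficient -1/3 offsets the derivative -3 of the map
    \<open>t \<mapsto> - t ^ 3\<close> at \<open>q x = 1\<close>, so that \<phi> has differential
    \<open>L\<close>.\<close>
  define q where "q y = 1 + ((-1/3) * L (y + - x) + (- C) * ((y + - x) \<bullet> (y + - x)))" for y
  define \<phi> where "\<phi> y = (-1) * max 0 (q y) ^ 3" for y
  have shift: "Ck_on 2 (\<lambda>y. y + - x) UNIV"
    by (intro Ck_on_add Ck_on_ident Ck_on_const open_UNIV)
  have "Ck_on 2 q UNIV"
    unfolding q_def[abs_def]
    by (intro Ck_on_add Ck_on_mult Ck_on_const open_UNIV shift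
        Ck_on_bounded_linear_compose[OF bl] Ck_on_bilinear[OF bounded_bilinear_inner])
  then have "Ck_on 2 (\<lambda>y. max 0 (q y) ^ 3) UNIV"
    by (intro Ck_on_compose[OF open_UNIV open_UNIV _ _ Ck_on_2_max_0_cube]) auto
  then have C2: "Ck_on 2 \<phi> UNIV"
    unfolding \<phi>_def[abs_def] by (intro Ck_on_mult Ck_on_const open_UNIV)
  have qx: "q x = 1"
    by (simp add: q_def linear_0[OF L])
  have "(q has_derivative (\<lambda>h. (-1/3) * L h)) (at x)"
    unfolding q_def[abs_def]
    by (auto intro!: derivative_eq_intros bounded_linear.has_derivative[OF bl])
  moreover have "((\<lambda>t. max 0 t ^ 3) has_derivative (*) 3) (at (q x))"
    using has_real_derivative_max_0_power[of 1 "q x"] qx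
    by (simp add: has_field_derivative_def numeral_3_eq_3 numeral_2_eq_2)
  ultimately have "((\<lambda>t. max 0 t ^ 3) \<circ> q has_derivative (*) 3 \<circ> (\<lambda>h. (-1/3) * L h)) (at x)"
    by (rule diff_chain_at)
  from has_derivative_mult_right[OF this, of "-1"] have "(\<phi> has_derivative L) (at x)"
    by (simp add: \<phi>_def[abs_def] o_def)
  moreover have "\<phi> y = 0" if "r \<le> dist x y" for y
  proof -
    let ?n = "norm (y - x)"
    have n: "r \<le> ?n"
      using that by (simp add: dist_norm norm_minus_commute)
    have "1 \<le> (?n / r)\<^sup>2"
      using n r by (simp add: one_le_power)
    moreover have "K * ?n / 3 * 1 \<le> K * ?n / 3 * (?n / r)"
      using n r K by (intro mult_left_mono) auto
    moreover have "C * ?n\<^sup>2 = (?n / r)\<^sup>2 + K * ?n / 3 * (?n / r)"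
      by (simp add: C_def power2_eq_square algebra_simps)
    moreover have "- L (y - x) \<le> K * ?n"
      using K(2)[of "y - x"] by (simp add: mult.commute)
    ultimately have "q y \<le> 0"
      by (simp add: q_def flip: power2_norm_eq_inner)
    then show ?thesis
      by (simp add: \<phi>_def)
  qed
  ultimately show ?thesis
    using that[OF C2 _ _ ] qx by (simp add: \<phi>_def)
qed

text \<open>Since \<open>a\<close> vanishes at \<open>x\<close>, the second derivatives of
  \<open>b\<close> drop out and its differential enters only through the two cross terms. These are
  zero on the kernel of the differential of \<open>a\<close> and adjustable elsewhere.\<close>

lemma hess_form_mult:
  fixes a b :: "real^'n::finite \<Rightarrow> real"
  assumes W: "open W" "x \<in> W" and a: "Ck_on 2 a W" "a x = 0" and b: "Ck_on 2 b W" "b x = -1"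
  shows "frechet_derivative (\<lambda>y. a y * b y) (at x) v = - frechet_derivative a (at x) v"
    and "hess_form G (\<lambda>y. a y * b y) x u v = - hess_form G a x u v
      + frechet_derivative a (at x) u * frechet_derivative b (at x) v
      + frechet_derivative a (at x) v * frechet_derivative b (at x) u"
proof -
  have d: "(a has_derivative frechet_derivative a (at y)) (at y)" "(b has_derivative frechet_derivative b (at y)) (at y)"
    "((\<lambda>y. frechet_derivative a (at y) v) has_derivative frechet_derivative (\<lambda>y. frechet_derivative a (at y) v) (at y)) (at y)"
    "((\<lambda>y. frechet_derivative b (at y) v) has_derivative frechet_derivative (\<lambda>y. frechet_derivative b (at y) v) (at y)) (at y)"
    if "y \<in> W" for y v
    using that a b by (auto simp: numeral_2_eq_2 frechet_derivative_works[symmetric])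
  have D: "frechet_derivative (\<lambda>y. a y * b y) (at y) v = a y * frechet_derivative b (at y) v + frechet_derivative a (at y) v * b y"
    if "y \<in> W" for y v
    using fun_cong[OF frechet_derivative_at[OF has_derivative_mult[OF d(1,2)[OF that]], symmetric], of v] .
  show "frechet_derivative (\<lambda>y. a y * b y) (at x) v = - frechet_derivative a (at x) v" for v
    using D[OF W(2)] a(2) b(2) by simp
  note first = this
  have "((\<lambda>y. a y * frechet_derivative b (at y) v + frechet_derivative a (at y) v * b y) has_derivative
     (\<lambda>u. (a x * frechet_derivative (\<lambda>y. frechet_derivative b (at y) v) (at x) u
         + frechet_derivative a (at x) u * frechet_derivative b (at x) v)
       + (frechet_derivative a (at x) v * frechet_derivative b (at x) u
         + frechet_derivative (\<lambda>y. frechet_derivative a (at y) v) (at x) u * b x))) (at x)"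
    by (rule has_derivative_add; rule has_derivative_mult; rule d[OF W(2)])
  then have "((\<lambda>y. frechet_derivative (\<lambda>y. a y * b y) (at y) v) has_derivative
     (\<lambda>u. (a x * frechet_derivative (\<lambda>y. frechet_derivative b (at y) v) (at x) u
         + frechet_derivative a (at x) u * frechet_derivative b (at x) v)
       + (frechet_derivative a (at x) v * frechet_derivative b (at x) u
         + frechet_derivative (\<lambda>y. frechet_derivative a (at y) v) (at x) u * b x))) (at x)"
    by (rule has_derivative_transform_within_open[OF _ W]) (simp add: D)
  from fun_cong[OF frechet_derivative_at[OF this, symmetric], of u]
  show "hess_form G (\<lambda>y. a y * b y) x u v = - hess_form G a x u v
      + frechet_derivative a (at x) u * frechet_derivative b (at x) v
      + frechet_derivative a (at x) v * frechet_derivative b (at x) u"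
    unfolding hess_form_def first a(2) b(2) by simp
qed

text \<open>Transfers second-order data from the globally defined coordinate function to the
  manifold function read in a chart; the two agree only on the chart's range.\<close>

lemma hess_form_cong:
  assumes W: "open W" "x \<in> W" and eq: "\<And>y. y \<in> W \<Longrightarrow> F y = F' y" and F: "Ck_on 2 F W"
  shows "hess_form G F x u v = hess_form G F' x u v"
    and "frechet_derivative F (at x) v = frechet_derivative F' (at x) v"
proof -
  have D: "frechet_derivative F (at y) = frechet_derivative F' (at y)" if "y \<in> W" for y
    by (rule frechet_derivative_transform_within_open[OF _ W(1) that eq]) (use F that in \<open>auto simp: numeral_2_eq_2\<close>)
  then show "frechet_derivative F (at x) v = frechet_derivative F' (at x) v"
    using W by simp
  have "frechet_derivative (\<lambda>y. frechet_derivative F (at y) v) (at x) = frechet_derivative (\<lambda>y. frechet_derivative F' (at y) v) (at x)"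
    by (rule frechet_derivative_transform_within_open[OF _ W]) (use F W D in \<open>auto simp: numeral_2_eq_2\<close>)
  then show "hess_form G F x u v = hess_form G F' x u v"
    using D[OF W(2)] by (simp add: hess_form_def)
qed

text \<open>The derivative \<open>L\<close> of \<open>\<phi>\<close> at \<open>x\<close> solves
  \<open>- Hess w(V, v) + dw(V) L(v) + dw(v) L(V) = \<Lambda> \<langle>V, v\<rangle>\<close>.\<close>

lemma test_function_exists:
  fixes G :: "real^'n \<Rightarrow> real^'n^'n::finite" and V :: "real^'n"
  assumes W: "open W" "x \<in> W" and w: "Ck_on 2 w W" "w x = 0"
    and G: "V \<bullet> (G x *v V) = 1" "\<And>v. frechet_derivative w (at x) v = \<sigma> * (V \<bullet> (G x *v v))"
    and \<sigma>: "\<sigma> > 0" and r: "r > 0"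
  obtains \<phi> where "Ck_on 2 \<phi> UNIV" "\<And>y. \<phi> y \<le> 0" "\<And>y. r \<le> dist x y \<Longrightarrow> \<phi> y = 0"
    "\<And>v. frechet_derivative (\<lambda>y. w y * \<phi> y) (at x) v = - \<sigma> * (V \<bullet> (G x *v v))"
    "\<And>v. hess_form G (\<lambda>y. w y * \<phi> y) x V v = \<Lambda> * (V \<bullet> (G x *v v))"
    "\<And>u v. V \<bullet> (G x *v u) = 0 \<Longrightarrow> V \<bullet> (G x *v v) = 0 \<Longrightarrow>
       hess_form G (\<lambda>y. w y * \<phi> y) x u v = - hess_form G w x u v"
proof -
  \<comment> \<open>Inserting the ansatz for \<open>L\<close> into the equation gives
    \<open>\<Lambda> = 2 * \<beta> + hess_form G w x V V\<close>: the normal component of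
    \<open>L\<close> occurs in both cross terms, hence the division by 2.\<close>
  define \<beta> where "\<beta> = (\<Lambda> - hess_form G w x V V) / 2"
  define L where "L v = (hess_form G w x V v + \<beta> * (V \<bullet> (G x *v v))) / \<sigma>" for v
  note bil = bilinear_hess_form[OF w(1) W, of G]
  have "linear L"
    by (rule linearI)
      (simp_all add: L_def bilinear_radd[OF bil] bilinear_rmul[OF bil] matrix_vector_right_distrib
        inner_add_right matrix_vector_mult_scaleR add_divide_distrib distrib_left)
  then obtain \<phi> where \<phi>: "Ck_on 2 \<phi> UNIV" "\<And>y. \<phi> y \<le> 0" "\<phi> x = -1" "(\<phi> has_derivative L) (at x)"
    "\<And>y. r \<le> dist x y \<Longrightarrow> \<phi> y = 0"
    using C2_bump_exists r by blast
  have \<phi>W: "Ck_on 2 \<phi> W"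
    by (rule Ck_on_subset[OF \<phi>(1)]) simp
  have D\<phi>: "frechet_derivative \<phi> (at x) = L"
    using frechet_derivative_at[OF \<phi>(4)] by simp
  note prod = hess_form_mult[OF W w \<phi>W \<phi>(3), unfolded D\<phi>]
  have "hess_form G (\<lambda>y. w y * \<phi> y) x V v = \<Lambda> * (V \<bullet> (G x *v v))" for v
    using \<sigma> G(1) unfolding prod G(2) L_def \<beta>_def by (simp add: field_simps)
  then show ?thesis
    using that[OF \<phi>(1,2,5)] prod G(2) by simp
qed

section \<open>Charts and smooth regions\<close>

context smooth_manifold
begin

lemma topspace_chart: "c \<in> A \<Longrightarrow> topspace (subtopology X (fst c)) = fst c"
  by (simp add: Int_absorb1 openin_subset chart_domain)

lemma inj_on_chart: "c \<in> A \<Longrightarrow> inj_on (snd c) (fst c)"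
  using homeomorphic_imp_injective_map[OF chart_homeomorphic] topspace_chart by metis

lemma chart_inv_chart: "c \<in> A \<Longrightarrow> q \<in> fst c \<Longrightarrow> chart_inv c (snd c q) = q"
  by (simp add: chart_inv_def inj_on_chart)

lemma chart_image_iff: "c \<in> A \<Longrightarrow> q \<in> fst c \<Longrightarrow> snd c q \<in> snd c ` (S \<inter> fst c) \<longleftrightarrow> q \<in> S"
  using inj_on_image_mem_iff[OF inj_on_chart, of c q "S \<inter> fst c"] by auto

lemma open_chart_image:
  assumes "c \<in> A" "openin X U"
  shows "open (snd c ` (U \<inter> fst c))"
proof -
  have "openin (subtopology X (fst c)) (U \<inter> fst c)"
    using assms(2) by (simp add: openin_subtopology_Int)
  then have "openin (top_of_set (snd c ` fst c)) (snd c ` (U \<inter> fst c))"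
    using homeomorphic_imp_open_map[OF chart_homeomorphic[OF assms(1)]] by (simp add: open_map_def)
  then show ?thesis
    using chart_range[OF assms(1)] openin_open_eq by blast
qed

lemma openin_chart_preimage:
  assumes "c \<in> A" "open S"
  shows "openin X {q \<in> fst c. snd c q \<in> S}"
proof -
  have "openin (subtopology X (fst c)) {q \<in> topspace (subtopology X (fst c)). snd c q \<in> snd c ` fst c \<inter> S}"
    by (rule openin_continuous_map_preimage[OF homeomorphic_imp_continuous_map[OF chart_homeomorphic[OF assms(1)]]
          openin_open_Int[OF assms(2)]])
  moreover have "{q \<in> topspace (subtopology X (fst c)). snd c q \<in> snd c ` fst c \<inter> S} = {q \<in> fst c. snd c q \<in> S}"
    unfolding topspace_chart[OF assms(1)] by auto
  ultimately show ?thesis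
    using chart_domain[OF assms(1)] by (simp add: openin_open_subtopology)
qed

text \<open>Here the Hausdorff property enters: a compact set inside one chart is closed in the
  whole manifold, so its complement is an open set on which the extension by zero is
  constant.\<close>

lemma closedin_chart_preimage_compact:
  assumes "c \<in> A" "compact K" "K \<subseteq> snd c ` fst c"
  shows "closedin X {q \<in> fst c. snd c q \<in> K}"
proof -
  let ?K = "{q \<in> fst c. snd c q \<in> K}"
  have "snd c ` ?K = K"
    using assms(3) by auto
  then have "compactin (top_of_set (snd c ` fst c)) (snd c ` ?K)"
    using assms by (simp add: compactin_subtopology)
  then have "compactin (subtopology X (fst c)) ?K"
    using homeomorphic_map_compactness[OF chart_homeomorphic[OF assms(1)], of ?K] topspace_chart[OF assms(1)]
    by auto
  then show ?thesis
    using compactin_imp_closedin[OF hausdorff] by (simp add: compactin_subtopology)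
qed

text \<open>In any other chart \<open>d\<close> two open sets cover the range: the overlap with
  \<open>c\<close>, where the function is \<open>F\<close> after a transition map, and the
  complement of the support, where it is 0.\<close>

lemma Ck_function_on_zero_extension:
  assumes c: "c \<in> A" and F: "Ck_on k F UNIV" and K: "compact K" "K \<subseteq> snd c ` fst c" "\<And>y. y \<notin> K \<Longrightarrow> F y = 0"
  shows "Ck_function_on A k (\<lambda>q. if q \<in> fst c then F (snd c q) else 0) (topspace X)"
  unfolding Ck_function_on_def
proof
  fix d assume d: "d \<in> A"
  let ?f = "\<lambda>q. if q \<in> fst c then F (snd c q) else 0"
  let ?K = "{q \<in> fst c. snd c q \<in> K}"
  let ?S1 = "snd d ` (fst c \<inter> fst d)" and ?S2 = "snd d ` ((topspace X - ?K) \<inter> fst d)"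
  have o1: "open ?S1"
    by (rule open_chart_image[OF d chart_domain[OF c]])
  have o2: "open ?S2"
    using closedin_chart_preimage_compact[OF c K(1,2)] by (intro open_chart_image[OF d]) auto
  have "Ck_on k (transition d c) ?S1"
    using charts_compatible[OF d c] by (simp add: smooth_on_def Int_commute)
  then have "Ck_on k (\<lambda>y. F (transition d c y)) ?S1"
    by (rule Ck_on_compose[OF o1 open_UNIV _ _ F, rotated]) simp
  then have "Ck_on k (?f \<circ> chart_inv d) ?S1"
    by (rule Ck_on_cong[OF o1, rotated]) (auto simp: transition_def chart_inv_chart d)
  moreover have "Ck_on k (\<lambda>y. 0::real) ?S2"
    by (rule Ck_on_const)
  then have "Ck_on k (?f \<circ> chart_inv d) ?S2"
  proof (rule Ck_on_cong[OF o2, rotated])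
    fix y assume "y \<in> ?S2"
    then obtain q where "q \<in> fst d" "q \<notin> ?K" "y = snd d q"
      by blast
    then show "0 = (?f \<circ> chart_inv d) y"
      using K(3)[of "snd c q"] by (auto simp: chart_inv_chart d)
  qed
  ultimately have "Ck_on k (?f \<circ> chart_inv d) (?S1 \<union> ?S2)"
    by (intro Ck_on_Un o1 o2)
  moreover have "snd d ` (topspace X \<inter> fst d) \<subseteq> ?S1 \<union> ?S2"
    by auto
  ultimately show "Ck_on k (?f \<circ> chart_inv d) (snd d ` (topspace X \<inter> fst d))"
    by (rule Ck_on_subset)
qed

end

section \<open>A smooth region in one chart: frontier, tangent space and normals from a defining
  function\<close>

locale region_chart = C1_riemannian_manifold X A g
  for X :: "'a topology" and A :: "('a, 'n::finite) chart set" and g :: "('a, 'n) metric" +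
  fixes N U :: "'a set" and w :: "'a \<Rightarrow> real" and c :: "('a, 'n) chart"
  assumes closed_N: "closedin X N" and open_U: "openin X U"
    and w_C2: "Ck_function_on A 2 w U"
    and w_regular: "q \<in> U \<Longrightarrow> q \<in> fst c \<Longrightarrow> frechet_derivative (w \<circ> chart_inv c) (at (snd c q)) \<noteq> (\<lambda>_. 0)"
    and N_eq: "N \<inter> U = {q \<in> U. 0 \<le> w q}"
    and c: "c \<in> A"
begin

abbreviation "u \<equiv> w \<circ> chart_inv c"
abbreviation "G \<equiv> metric_coeff g c"
abbreviation "W \<equiv> snd c ` (U \<inter> fst c)"

lemma open_W: "open W"
  by (rule open_chart_image[OF c open_U])

lemma u_C2: "Ck_on 2 u W"
  using w_C2 c by (simp add: Ck_function_on_def)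

lemma u_chart: "q \<in> fst c \<Longrightarrow> u (snd c q) = w q"
  by (simp add: chart_inv_chart[OF c])

lemma u_differentiable: "y \<in> W \<Longrightarrow> u differentiable (at y)"
  by (rule differentiableI[OF Ck_on_has_derivative[OF u_C2[unfolded numeral_2_eq_2]]])

lemma u_has_derivative: "y \<in> W \<Longrightarrow> (u has_derivative (\<lambda>v. gradient u y \<bullet> v)) (at y)"
  using u_differentiable[of y] gradient_inner[OF u_differentiable] by (simp add: frechet_derivative_works)

lemma continuous_on_u: "continuous_on W u"
  by (meson continuous_at_imp_continuous_on differentiable_imp_continuous_within u_differentiable)

lemma gradient_u_nonzero:
  assumes "y \<in> W"
  shows "gradient u y \<noteq> 0"
proof
  assume "gradient u y = 0"
  then have "frechet_derivative u (at y) = (\<lambda>_. 0)"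
    using gradient_inner[OF u_differentiable[OF assms]] by auto
  then show False
    using assms w_regular by auto
qed

lemma u_line_has_derivative:
  assumes "y \<in> W"
  shows "((\<lambda>t. u (y + t *\<^sub>R v)) has_real_derivative gradient u y \<bullet> v) (at 0)"
proof -
  have "((\<lambda>t. y + t *\<^sub>R v) has_derivative (\<lambda>t. t *\<^sub>R v)) (at 0)"
    by (auto intro!: derivative_eq_intros)
  moreover have "(u has_derivative (\<lambda>v. gradient u y \<bullet> v)) (at (y + 0 *\<^sub>R v))"
    using u_has_derivative[OF assms] by simp
  ultimately have "(u \<circ> (\<lambda>t. y + t *\<^sub>R v) has_derivative (\<lambda>v. gradient u y \<bullet> v) \<circ> (\<lambda>t. t *\<^sub>R v)) (at 0)"
    by (rule diff_chain_at)
  then show ?thesis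
    by (simp add: has_field_derivative_def o_def mult_commute_abs)
qed

lemma line_eventually_in:
  fixes y v :: "real^'n"
  assumes "open S" "y \<in> S"
  shows "\<forall>\<^sub>F t in at_right 0. y + t *\<^sub>R v \<in> S"
proof -
  have "((\<lambda>t. y + t *\<^sub>R v) \<longlongrightarrow> y + 0 *\<^sub>R v) (at_right 0)"
    by (intro tendsto_intros)
  then show ?thesis
    using assms by (auto dest: topological_tendstoD)
qed

lemma in_N_iff: "q \<in> U \<Longrightarrow> q \<in> N \<longleftrightarrow> 0 \<le> w q"
  using N_eq by blast

text \<open>Where \<open>w\<close> is positive, a whole neighbourhood lies in \<open>N\<close>. At a
  zero of \<open>w\<close> the differential is nonzero, so moving against the coordinate gradient
  makes \<open>w\<close> negative and leaves \<open>N\<close> at once.\<close>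

lemma frontier_iff:
  assumes q: "q \<in> U" "q \<in> fst c"
  shows "q \<in> X frontier_of N \<longleftrightarrow> w q = 0"
proof -
  let ?y = "snd c q"
  have y: "?y \<in> W"
    using q by blast
  have N: "q \<in> N" if "q \<in> X frontier_of N"
    using that frontier_of_subset_closedin[OF closed_N] by blast
  have "q \<in> X interior_of N \<longleftrightarrow> w q > 0" if "q \<in> N"
  proof
    assume "w q > 0"
    have "open (W \<inter> u -` {0<..})"
      by (rule continuous_open_preimage[OF continuous_on_u open_W]) simp
    then have "openin X {q \<in> fst c. snd c q \<in> W \<inter> u -` {0<..}}"
      by (rule openin_chart_preimage[OF c])
    moreover have "{q \<in> fst c. snd c q \<in> W \<inter> u -` {0<..}} \<subseteq> N"
    proof
      fix z assume "z \<in> {q \<in> fst c. snd c q \<in> W \<inter> u -` {0<..}}"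
      then have "z \<in> fst c" "snd c z \<in> W" "0 < u (snd c z)"
        by blast+
      then show "z \<in> N"
        using chart_image_iff[OF c, of z U] in_N_iff[of z] u_chart[of z] by simp
    qed
    moreover have "q \<in> {q \<in> fst c. snd c q \<in> W \<inter> u -` {0<..}}"
      using q(2) y \<open>w q > 0\<close> u_chart[OF q(2)] by simp
    ultimately show "q \<in> X interior_of N"
      unfolding interior_of_def by blast
  next
    assume "q \<in> X interior_of N"
    then obtain T where T: "openin X T" "q \<in> T" "T \<subseteq> N"
      unfolding interior_of_def by blast
    let ?S = "snd c ` ((T \<inter> U) \<inter> fst c)"
    have "open ?S"
      using T open_U by (intro open_chart_image[OF c]) auto
    moreover have "?y \<in> ?S"
      using T q by blast
    ultimately have "\<forall>\<^sub>F t in at_right 0. ?y + t *\<^sub>R (- gradient u ?y) \<in> ?S"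
      by (rule line_eventually_in)
    then have ev: "\<forall>\<^sub>F t in at_right 0. 0 \<le> u (?y + t *\<^sub>R (- gradient u ?y))"
    proof eventually_elim
      case (elim t)
      then obtain z where "z \<in> T" "z \<in> U" "z \<in> fst c" "?y + t *\<^sub>R (- gradient u ?y) = snd c z"
        by blast
      then show ?case
        using T(3) in_N_iff[of z] u_chart[of z] by (metis subsetD)
    qed
    show "w q > 0"
    proof (rule ccontr)
      assume "\<not> w q > 0"
      then have "w q = 0"
        using in_N_iff[OF q(1)] that by simp
      have "gradient u ?y \<bullet> - gradient u ?y < 0"
        using gradient_u_nonzero[OF y] by simp
      from DERIV_neg_dec_right[OF u_line_has_derivative[OF y] this]
      obtain d where d: "d > 0" "\<And>t. 0 < t \<Longrightarrow> t < d \<Longrightarrow> u (?y + t *\<^sub>R (- gradient u ?y)) < 0"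
        using \<open>w q = 0\<close> u_chart[OF q(2)] by auto
      then have "\<forall>\<^sub>F t in at_right 0. u (?y + t *\<^sub>R (- gradient u ?y)) < 0"
        unfolding eventually_at_right_field by (intro exI[of _ d]) auto
      with ev have "\<forall>\<^sub>F t in at_right (0::real). False"
        by eventually_elim simp
      then show False
        by simp
    qed
  qed
  moreover have "q \<in> X frontier_of N \<longleftrightarrow> q \<in> N \<and> q \<notin> X interior_of N"
    using closed_N by (simp add: frontier_of_def closure_of_closedin)
  ultimately show ?thesis
    using in_N_iff[OF q(1)] by (metis less_le order_refl)
qed

lemma frontier_chart_image: "snd c ` (fst c \<inter> X frontier_of N) \<inter> W = {y \<in> W. u y = 0}"
proof -
  have "snd c q \<in> snd c ` (X frontier_of N \<inter> fst c) \<longleftrightarrow> u (snd c q) = 0" if "q \<in> U" "q \<in> fst c" for q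
    unfolding chart_image_iff[OF c that(2)] frontier_iff[OF that] u_chart[OF that(2)] ..
  then have "y \<in> snd c ` (X frontier_of N \<inter> fst c) \<longleftrightarrow> u y = 0" if "y \<in> W" for y
    using that by (elim imageE) simp
  moreover have "fst c \<inter> X frontier_of N = X frontier_of N \<inter> fst c"
    by (rule Int_commute)
  ultimately show ?thesis
    by auto
qed

lemma boundary_tangent_eq:
  assumes "q \<in> U" "q \<in> fst c" "q \<in> X frontier_of N"
  shows "boundary_tangent X N c q = {v. gradient u (snd c q) \<bullet> v = 0}"
proof -
  have y: "snd c q \<in> W"
    using assms by blast
  have "(\<lambda>v. gradient u (snd c q) \<bullet> v) \<noteq> (\<lambda>_. 0)"
  proof
    assume "(\<lambda>v. gradient u (snd c q) \<bullet> v) = (\<lambda>_. 0)"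
    from fun_cong[OF this, of "gradient u (snd c q)"] show False
      using gradient_u_nonzero[OF y] by simp
  qed
  moreover have "u (snd c q) = 0"
    using assms frontier_iff u_chart by simp
  ultimately show ?thesis
    unfolding boundary_tangent_def
    using level_set_tangents[OF open_W y continuous_on_u u_has_derivative[OF y] _ _ frontier_chart_image]
    by simp
qed

lemma metric_inner_eq: "q \<in> fst c \<Longrightarrow> metric_inner g c q = (\<lambda>v v'. v \<bullet> (G (snd c q) *v v'))"
  by (simp add: fun_eq_iff metric_inner_def metric_coeff_def chart_inv_chart[OF c])

lemma pos_def_G: "y \<in> snd c ` fst c \<Longrightarrow> pos_def_matrix (G y)"
  using metric_sym[OF c] metric_pos[OF c] by (auto simp: pos_def_matrix_def metric_coeff_def chart_inv_chart[OF c])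

lemma G_C1: "Ck_on 1 G (snd c ` fst c)"
  using metric_C1[OF c] by (simp only: metric_coeff_def[abs_def])

text \<open>Staying in \<open>N\<close> for small positive times gives only a nonnegative derivative
  of \<open>u\<close> along \<nu>. It cannot be 0, since \<nu> would then be tangent and orthogonal
  to itself, against its unit length.\<close>

lemma inward_unit_normal_iff:
  assumes q: "q \<in> U" "q \<in> fst c" "q \<in> X frontier_of N"
  shows "inward_unit_normal X g N c q \<nu> \<longleftrightarrow>
    \<nu> \<bullet> (G (snd c q) *v \<nu>) = 1 \<and> (\<forall>v. gradient u (snd c q) \<bullet> v = 0 \<longrightarrow> \<nu> \<bullet> (G (snd c q) *v v) = 0) \<and>
    gradient u (snd c q) \<bullet> \<nu> > 0"
proof -
  let ?y = "snd c q"
  have y: "?y \<in> W" "?y \<in> snd c ` fst c"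
    using q by auto
  have u0: "u ?y = 0"
    using frontier_iff q u_chart by simp
  have inN: "z \<in> snd c ` (fst c \<inter> N) \<longleftrightarrow> 0 \<le> u z" if "z \<in> W" for z
  proof -
    obtain q where "z = snd c q" "q \<in> U" "q \<in> fst c"
      using \<open>z \<in> W\<close> by blast
    then show ?thesis
      using chart_image_iff[OF c, of q N] in_N_iff[of q] u_chart[of q] by (metis Int_commute)
  qed
  have pos: "\<forall>\<^sub>F t in at_right 0. ?y + t *\<^sub>R \<nu> \<in> snd c ` (fst c \<inter> N)" if *: "gradient u ?y \<bullet> \<nu> > 0"
  proof -
    from DERIV_pos_inc_right[OF u_line_has_derivative[OF y(1)] *]
    obtain d where d: "d > 0" "\<And>t. 0 < t \<Longrightarrow> t < d \<Longrightarrow> 0 < u (?y + t *\<^sub>R \<nu>)"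
      using u0 by auto
    then have "\<forall>\<^sub>F t in at_right 0. 0 < u (?y + t *\<^sub>R \<nu>)"
      unfolding eventually_at_right_field by (intro exI[of _ d]) auto
    with line_eventually_in[OF open_W y(1), of \<nu>] show ?thesis
      by eventually_elim (simp add: inN less_imp_le)
  qed
  have nonneg: "gradient u ?y \<bullet> \<nu> \<ge> 0" if ev: "\<forall>\<^sub>F t in at_right 0. ?y + t *\<^sub>R \<nu> \<in> snd c ` (fst c \<inter> N)"
  proof (rule ccontr)
    assume "\<not> gradient u ?y \<bullet> \<nu> \<ge> 0"
    then have "gradient u ?y \<bullet> \<nu> < 0" by simp
    from DERIV_neg_dec_right[OF u_line_has_derivative[OF y(1)] this]
    obtain d where d: "d > 0" "\<And>t. 0 < t \<Longrightarrow> t < d \<Longrightarrow> u (?y + t *\<^sub>R \<nu>) < 0"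
      using u0 by auto
    then have "\<forall>\<^sub>F t in at_right 0. u (?y + t *\<^sub>R \<nu>) < 0"
      unfolding eventually_at_right_field by (intro exI[of _ d]) auto
    with line_eventually_in[OF open_W y(1), of \<nu>] ev have "\<forall>\<^sub>F t in at_right (0::real). False"
      by eventually_elim (use inN in force)
    then show False by simp
  qed
  have nz: "gradient u ?y \<bullet> \<nu> \<noteq> 0"
    if "\<nu> \<bullet> (G ?y *v \<nu>) = 1" "\<forall>v. gradient u ?y \<bullet> v = 0 \<longrightarrow> \<nu> \<bullet> (G ?y *v v) = 0"
    using that by force
  have "(\<forall>\<^sub>F t in at_right 0. ?y + t *\<^sub>R \<nu> \<in> snd c ` (fst c \<inter> N)) \<longleftrightarrow> gradient u ?y \<bullet> \<nu> > 0"
    if "\<nu> \<bullet> (G ?y *v \<nu>) = 1" "\<forall>v. gradient u ?y \<bullet> v = 0 \<longrightarrow> \<nu> \<bullet> (G ?y *v v) = 0"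
  proof
    show "gradient u ?y \<bullet> \<nu> > 0" if "\<forall>\<^sub>F t in at_right 0. ?y + t *\<^sub>R \<nu> \<in> snd c ` (fst c \<inter> N)"
      using nonneg[OF that] nz[OF \<open>\<nu> \<bullet> (G ?y *v \<nu>) = 1\<close> \<open>\<forall>v. gradient u ?y \<bullet> v = 0 \<longrightarrow> _ v\<close>] by linarith
  qed (rule pos)
  then show ?thesis
    unfolding inward_unit_normal_def boundary_tangent_eq[OF q] metric_inner_eq[OF q(2)] Ball_def mem_Collect_eq
    by blast
qed

text \<open>Guarantees that the \<open>SOME\<close> in \<open>second_fundamental_form\<close>
  selects a genuine normal field.\<close>

lemma normal_field_exists:
  assumes p: "p \<in> U" "p \<in> fst c"
  shows "\<exists>V. normal_field X g N c p V"
proof -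
  have sub: "W \<subseteq> snd c ` fst c"
    by auto
  obtain V where V: "Ck_on 1 V W" "\<And>y. y \<in> W \<Longrightarrow> V y \<bullet> (G y *v V y) = 1"
    "\<And>y v. y \<in> W \<Longrightarrow> gradient u y \<bullet> v = 0 \<Longrightarrow> V y \<bullet> (G y *v v) = 0"
    "\<And>y. y \<in> W \<Longrightarrow> gradient u y \<bullet> V y > 0"
    by (rule C1_unit_normal_exists[OF open_W Ck_on_subset[OF G_C1 sub] pos_def_G[OF subsetD[OF sub]] u_C2 gradient_u_nonzero])
      (assumption | (erule that; assumption))+
  have "inward_unit_normal X g N c q (V (snd c q))"
    if "q \<in> fst c \<inter> X frontier_of N" "snd c q \<in> W" for q
  proof -
    have q: "q \<in> fst c" "q \<in> X frontier_of N" "q \<in> U"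
      using that chart_image_iff[OF c, of q U] by auto
    show ?thesis
      unfolding inward_unit_normal_iff[OF q(3,1,2)] using V(2-4)[OF that(2)] by blast
  qed
  then show ?thesis
    unfolding normal_field_def using V(1) open_W sub p by (intro exI[of _ V] exI[of _ W]) blast
qed

end

section \<open>Principal curvatures, the spectrum of the test function, and the inequality\<close>

lemma sum_list_take_map_append:
  fixes l :: "real list"
  assumes "m \<le> length l"
  shows "sum_list (take m (map ((*) \<sigma>) l @ [\<Lambda>])) = \<sigma> * (\<Sum>i<m. l ! i)"
proof -
  have "sum_list (take m (map ((*) \<sigma>) l @ [\<Lambda>])) = (\<Sum>i = 0..<m. \<sigma> * l ! i)"
    using assms by (simp add: sum_list_sum_nth min_def)
  then show ?thesis
    by (simp add: sum_distrib_left atLeast0LessThan)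
qed

context region_chart
begin

lemma metric_inner_form:
  assumes "q \<in> fst c"
  shows "bilinear (metric_inner g c q)" "\<And>v v'. metric_inner g c q v v' = metric_inner g c q v' v"
    "\<And>v. v \<noteq> 0 \<Longrightarrow> metric_inner g c q v v > 0"
proof -
  have "pos_def_matrix (G (snd c q))"
    using pos_def_G assms by blast
  with pos_def_matrix_inner_commute[OF this]
  show "bilinear (metric_inner g c q)" "\<And>v v'. metric_inner g c q v v' = metric_inner g c q v' v"
    "\<And>v. v \<noteq> 0 \<Longrightarrow> metric_inner g c q v v > 0"
    unfolding metric_inner_eq[OF assms]
    by (auto simp: bilinear_def pos_def_matrix_def matrix_vector_right_distrib inner_add_right
        inner_add_left matrix_vector_mult_scaleR intro!: linearI)
qed

text \<open>The second fundamental form does not depend on the normal field chosen by \<open>SOME\<close>: it is a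
  multiple of the Hessian of the defining function.\<close>

lemma second_fundamental_form_eq:
  assumes p: "p \<in> U" "p \<in> fst c" "p \<in> X frontier_of N"
  obtains \<nu> \<sigma> where "inward_unit_normal X g N c p \<nu>" "\<sigma> > 0"
    "gradient u (snd c p) = \<sigma> *\<^sub>R (G (snd c p) *v \<nu>)"
    "bilinear (second_fundamental_form X g N c p)"
    "\<And>v v'. v \<in> boundary_tangent X N c p \<Longrightarrow> v' \<in> boundary_tangent X N c p \<Longrightarrow>
       hess_form G u (snd c p) v v' = - \<sigma> * second_fundamental_form X g N c p v v'"
proof -
  let ?x = "snd c p"
  define V where "V = (SOME V. normal_field X g N c p V)"
  have "normal_field X g N c p V"
    unfolding V_def using normal_field_exists[OF p(1,2)] by (rule someI_ex)
  then obtain W' where W': "open W'" "?x \<in> W'" "W' \<subseteq> snd c ` fst c" "Ck_on 1 V W'"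
    and normal: "\<And>q. q \<in> fst c \<inter> X frontier_of N \<Longrightarrow> snd c q \<in> W' \<Longrightarrow> inward_unit_normal X g N c q (V (snd c q))"
    unfolding normal_field_def by blast
  \<comment> \<open>The selected field comes with its own domain \<open>W'\<close>, while the
    defining function is controlled on \<open>W\<close>.\<close>
  let ?W = "W \<inter> W'"
  have xW: "?x \<in> W"
    using p by blast
  have oW: "open ?W" "?x \<in> ?W" and sub: "?W \<subseteq> W" "?W \<subseteq> snd c ` fst c"
    using W' xW open_W by auto
  have V_normal: "inward_unit_normal X g N c q (V (snd c q))"
      "(gradient u (snd c q) \<bullet> V (snd c q)) *\<^sub>R (G (snd c q) *v V (snd c q)) = gradient u (snd c q)"
    if q: "q \<in> U" "q \<in> fst c" "q \<in> X frontier_of N" "snd c q \<in> W'" for q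
  proof -
    have y: "snd c q \<in> W" "snd c q \<in> snd c ` fst c"
      using q by auto
    show n: "inward_unit_normal X g N c q (V (snd c q))"
      using normal q by blast
    have "(G (snd c q) *v V (snd c q)) \<bullet> v = 0" if "gradient u (snd c q) \<bullet> v = 0" for v
      using n that pos_def_G[OF y(2)] symmetric_matrix_inner[of "G (snd c q)" "V (snd c q)" v]
      unfolding inward_unit_normal_iff[OF q(1-3)] by (simp add: pos_def_matrix_def)
    then show "(gradient u (snd c q) \<bullet> V (snd c q)) *\<^sub>R (G (snd c q) *v V (snd c q)) = gradient u (snd c q)"
      using n gradient_u_nonzero[OF y(1)]
      unfolding inward_unit_normal_iff[OF q(1-3)] by (intro gradient_eq_normal) auto
  qed
  let ?\<sigma> = "gradient u ?x \<bullet> V ?x"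
  have Vx: "V differentiable (at ?x)" "G differentiable (at ?x)"
    using Ck_on_has_derivative[OF W'(4)[unfolded One_nat_def] W'(2)]
      Ck_on_has_derivative[OF G_C1[unfolded One_nat_def], of ?x] p(2)
    by (auto intro: differentiableI)
  have II: "second_fundamental_form X g N c p v v' = - (covariant_deriv G ?x v V \<bullet> (G ?x *v v'))" for v v'
    by (simp add: second_fundamental_form_def metric_inner_eq[OF p(2)] flip: V_def)
  have lin: "linear (frechet_derivative V (at ?x))"
    using Vx(1) by (rule linear_frechet_derivative)
  have "bilinear (second_fundamental_form X g N c p)"
    unfolding bilinear_def II covariant_deriv_eq
    by (auto intro!: linearI simp: linear_add[OF lin] linear_cmul[OF lin]
        bilinear_ladd[OF bilinear_christoffel_vec] bilinear_lmul[OF bilinear_christoffel_vec]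
        inner_add_left inner_add_right matrix_vector_right_distrib matrix_vector_mult_scaleR algebra_simps)
  moreover have "hess_form G u ?x v v' = - ?\<sigma> * second_fundamental_form X g N c p v v'"
    if "v \<in> boundary_tangent X N c p" "v' \<in> boundary_tangent X N c p" for v v'
  proof -
    have "hess_form G u ?x v v' = ?\<sigma> * (covariant_deriv G ?x v V \<bullet> (G ?x *v v'))"
    proof (rule hess_form_eq_covariant_deriv[OF oW Ck_on_subset[OF u_C2 sub(1)] _ Vx(2,1)])
      show "pos_def_matrix (G y)" if "y \<in> ?W" for y
        using pos_def_G sub(2) that by blast
      show "(gradient u y \<bullet> V y) *\<^sub>R (G y *v V y) = gradient u y" if "y \<in> ?W" "u y = 0" for y
      proof -
        obtain q where "q \<in> U" "q \<in> fst c" "y = snd c q"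
          using \<open>y \<in> ?W\<close> by blast
        then show ?thesis
          using that V_normal(2)[of q] frontier_iff[of q] u_chart[of q] by simp
      qed
      show "u ?x = 0"
        using frontier_iff[OF p(1,2)] p u_chart by simp
      show "gradient u ?x \<noteq> 0"
        by (rule gradient_u_nonzero[OF xW])
    qed (use that boundary_tangent_eq[OF p] in auto)
    then show ?thesis
      by (simp add: II)
  qed
  moreover have "?\<sigma> > 0"
    using V_normal(1)[OF p W'(2)] unfolding inward_unit_normal_iff[OF p] by blast
  ultimately show ?thesis
    using that V_normal[OF p W'(2)] by metis
qed

lemma principal_curvatures_exist:
  assumes p: "p \<in> U" "p \<in> fst c" "p \<in> X frontier_of N"
  obtains \<nu> \<sigma> l where "\<sigma> > 0" "\<nu> \<bullet> (G (snd c p) *v \<nu>) = 1"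
    "gradient u (snd c p) = \<sigma> *\<^sub>R (G (snd c p) *v \<nu>)"
    "boundary_tangent X N c p = {v. metric_inner g c p \<nu> v = 0}"
    "\<And>v v'. v \<in> boundary_tangent X N c p \<Longrightarrow> v' \<in> boundary_tangent X N c p \<Longrightarrow>
       hess_form G u (snd c p) v v' = - \<sigma> * second_fundamental_form X g N c p v v'"
    "length l = CARD('n) - 1" "sorted l"
    "\<And>\<mu>. count_list l \<mu> = dim (eigenspace (boundary_tangent X N c p) (metric_inner g c p)
       (second_fundamental_form X g N c p) \<mu>)"
proof -
  let ?x = "snd c p" and ?T = "boundary_tangent X N c p" and ?g = "metric_inner g c p"
    and ?II = "second_fundamental_form X g N c p"
  obtain \<nu> \<sigma> where \<nu>: "inward_unit_normal X g N c p \<nu>" and \<sigma>: "\<sigma> > 0"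
    and grad: "gradient u ?x = \<sigma> *\<^sub>R (G ?x *v \<nu>)" and bil: "bilinear ?II"
    and hess: "\<And>v v'. v \<in> ?T \<Longrightarrow> v' \<in> ?T \<Longrightarrow> hess_form G u ?x v v' = - \<sigma> * ?II v v'"
    using second_fundamental_form_eq[OF p] by blast
  have x: "?x \<in> W" "?x \<in> snd c ` fst c"
    using p by auto
  have posG: "pos_def_matrix (G ?x)"
    by (rule pos_def_G[OF x(2)])
  have \<nu>1: "\<nu> \<bullet> (G ?x *v \<nu>) = 1"
    using \<nu> unfolding inward_unit_normal_iff[OF p] by blast
  note g = metric_inner_form[OF p(2)]
  have T: "?T = {v. ?g \<nu> v = 0}"
    unfolding boundary_tangent_eq[OF p] grad metric_inner_eq[OF p(2)]
    using \<sigma> posG symmetric_matrix_inner[of "G ?x" \<nu>] by (auto simp: pos_def_matrix_def)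
  have subT: "subspace ?T"
    unfolding T using g(1) by (auto simp: subspace_def bilinear_rzero bilinear_radd bilinear_rmul)
  have Gd: "G differentiable (at ?x)"
    using Ck_on_has_derivative[OF G_C1[unfolded One_nat_def] x(2)] differentiableI by blast
  \<comment> \<open>Symmetry is inherited from the Hessian of \<open>u\<close>, to which the form is
    proportional on tangent vectors with nonzero factor \<open>- \<sigma>\<close>.\<close>
  have sym: "?II v v' = ?II v' v" if "v \<in> ?T" "v' \<in> ?T" for v v'
  proof -
    have "pos_def_matrix (G y)" if "y \<in> W" for y
      using pos_def_G that by blast
    from hess_form_commute[OF open_W x(1) this Gd u_C2] show ?thesis
      using hess[OF that] hess[OF that(2,1)] \<sigma> by (metis mult_cancel_left neg_equal_0_iff_equal less_irrefl)
  qed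
  obtain l where l: "sorted l" "length l = dim ?T" "\<And>\<mu>. count_list l \<mu> = dim (eigenspace ?T ?g ?II \<mu>)"
    using eigenvalues_exist[OF subT g bil sym] by blast
  have "\<nu> \<noteq> 0"
    using \<nu>1 by auto
  then have "dim ?T = CARD('n) - 1"
    using dim_orthogonal_split[OF subspace_UNIV g UNIV_I, of \<nu>] unfolding T by simp
  then show ?thesis
    using that[OF \<sigma> \<nu>1 grad T hess _ l(1,3)] l(2) by simp
qed

text \<open>Collects all that the coordinates have to deliver. The trace and the norm of the
  derivative carry the same factor \<sigma>, which then cancels. The chart must be
  \<open>chart_at A p\<close> because the pointwise quantities are defined in that chart.\<close>

lemma trace_hessian_test_function:
  assumes p: "p \<in> U" "p \<in> fst c" "p \<in> X frontier_of N" and chart: "c = chart_at A p"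
    and m: "m \<le> CARD('n) - 1"
  obtains f \<sigma> where "Ck_function_on A 2 f (topspace X)" "f p = 0" "\<And>q. q \<in> N \<Longrightarrow> f q \<le> 0"
    "\<sigma> > 0" "deriv_norm A g f p = \<sigma>"
    "trace_hessian A g m f p = \<sigma> * (\<Sum>i<m. principal_curvatures X A g N p ! i)"
proof -
  let ?x = "snd c p" and ?T = "boundary_tangent X N c p" and ?g = "metric_inner g c p"
    and ?II = "second_fundamental_form X g N c p"
  obtain \<nu> \<sigma> l where \<sigma>: "\<sigma> > 0" and \<nu>: "\<nu> \<bullet> (G ?x *v \<nu>) = 1"
    and grad: "gradient u ?x = \<sigma> *\<^sub>R (G ?x *v \<nu>)" and T: "?T = {v. ?g \<nu> v = 0}"
    and hess: "\<And>v v'. v \<in> ?T \<Longrightarrow> v' \<in> ?T \<Longrightarrow> hess_form G u ?x v v' = - \<sigma> * ?II v v'"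
    and l: "length l = CARD('n) - 1" "sorted l" "\<And>\<mu>. count_list l \<mu> = dim (eigenspace ?T ?g ?II \<mu>)"
    by (rule principal_curvatures_exist[OF p]) (erule that; assumption)
  have x: "?x \<in> W" "?x \<in> snd c ` fst c"
    using p by auto
  have ux: "u ?x = 0"
    using frontier_iff[OF p(1,2)] p u_chart by simp
  have posG: "pos_def_matrix (G ?x)"
    by (rule pos_def_G[OF x(2)])
  note g = metric_inner_form[OF p(2)]
  have du: "frechet_derivative u (at ?x) v = \<sigma> * (\<nu> \<bullet> (G ?x *v v))" for v
    using gradient_inner[OF u_differentiable[OF x(1)], of v] posG symmetric_matrix_inner[of "G ?x" \<nu> v]
    by (simp add: grad pos_def_matrix_def)
  obtain r where r: "r > 0" "cball ?x r \<subseteq> W"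
    using open_W x(1) open_contains_cball by blast
  obtain \<Lambda> where \<Lambda>: "\<And>a. a \<in> set l \<Longrightarrow> \<sigma> * a \<le> \<Lambda>"
    using bdd_above_finite[of "(*) \<sigma> ` set l"] by (auto simp: bdd_above_def)
  obtain \<phi> where \<phi>: "Ck_on 2 \<phi> UNIV" "\<And>y. \<phi> y \<le> 0" "\<And>y. r \<le> dist ?x y \<Longrightarrow> \<phi> y = 0"
    and dF: "\<And>v. frechet_derivative (\<lambda>y. u y * \<phi> y) (at ?x) v = - \<sigma> * (\<nu> \<bullet> (G ?x *v v))"
    and H\<nu>: "\<And>v. hess_form G (\<lambda>y. u y * \<phi> y) ?x \<nu> v = \<Lambda> * (\<nu> \<bullet> (G ?x *v v))"
    and HT: "\<And>v v'. \<nu> \<bullet> (G ?x *v v) = 0 \<Longrightarrow> \<nu> \<bullet> (G ?x *v v') = 0 \<Longrightarrow>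
       hess_form G (\<lambda>y. u y * \<phi> y) ?x v v' = - hess_form G u ?x v v'"
    by (rule test_function_exists[where G = G and \<Lambda> = \<Lambda>, OF open_W x(1) u_C2 ux \<nu> du \<sigma> r(1)])
      (erule that; assumption)
  define F where "F y = u y * \<phi> y" for y
  have FW: "Ck_on 2 F W"
    unfolding F_def[abs_def] by (intro Ck_on_mult open_W u_C2 Ck_on_subset[OF \<phi>(1)]) auto
  have F0: "F y = 0" if "y \<notin> cball ?x r" for y
    using \<phi>(3)[of y] that by (simp add: F_def)
  \<comment> \<open>The function \<open>u\<close> is controlled only on \<open>W\<close>, but \<phi>
    makes \<open>F\<close> zero off the closed ball. Since that ball lies in \<open>W\<close>, the
    two open sets cover the space.\<close>
  have "Ck_on 2 F (- cball ?x r)"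
    by (rule Ck_on_cong[where f = "\<lambda>_. 0"]) (use F0 in \<open>auto intro: Ck_on_const\<close>)
  then have "Ck_on 2 F (W \<union> - cball ?x r)"
    by (intro Ck_on_Un FW open_W) auto
  then have F: "Ck_on 2 F UNIV"
  proof -
    have "W \<union> - cball ?x r = UNIV"
      using r(2) by blast
    with \<open>Ck_on 2 F (W \<union> - cball ?x r)\<close> show ?thesis
      by simp
  qed
  define f where "f q = (if q \<in> fst c then F (snd c q) else 0)" for q
  have fC2: "Ck_function_on A 2 f (topspace X)"
    unfolding f_def[abs_def] using r(2) F0 by (intro Ck_function_on_zero_extension[OF c F compact_cball, of ?x r]) auto
  have fp: "f p = 0"
    using p(2) ux by (simp add: f_def F_def)
  have fN: "f q \<le> 0" if "q \<in> N" for q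
  proof (cases "q \<in> fst c \<and> snd c q \<in> cball ?x r")
    case True
    then have "q \<in> U"
      using r(2) chart_image_iff[OF c, of q U] by blast
    then have "0 \<le> u (snd c q)"
      using that in_N_iff u_chart True by simp
    then show ?thesis
      using True \<phi>(2)[of "snd c q"] by (simp add: f_def F_def mult_nonneg_nonpos)
  next
    case False
    then show ?thesis
      using F0 by (auto simp: f_def)
  qed
  have fF: "F y = (f \<circ> chart_inv c) y" if "y \<in> snd c ` fst c" for y
    using that by (auto simp: f_def chart_inv_chart[OF c])
  have FO: "Ck_on 2 F (snd c ` fst c)"
    by (rule Ck_on_subset[OF F]) simp
  note cong = hess_form_cong[OF chart_range[OF c] x(2) fF FO]
  have fO: "Ck_on 2 (f \<circ> chart_inv c) (snd c ` fst c)"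
    by (rule Ck_on_cong[OF chart_range[OF c] fF FO])
  have Hf: "hessian g c f p = hess_form G F ?x"
  proof (intro ext)
    show "hessian g c f p v v' = hess_form G F ?x v v'" for v v'
      unfolding hessian_def sum_hessian_coeff[OF fO chart_range[OF c] x(2)] by (rule cong(1)[symmetric])
  qed
  have dF': "frechet_derivative F (at ?x) v = - \<sigma> * (\<nu> \<bullet> (G ?x *v v))" for v
    using dF by (simp add: F_def[abs_def])
  have "(\<chi> i. partial i (f \<circ> chart_inv c) ?x) = - \<sigma> *\<^sub>R (G ?x *v \<nu>)"
  proof -
    have "partial i (f \<circ> chart_inv c) ?x = - \<sigma> * ((G ?x *v \<nu>) \<bullet> axis i 1)" for i
      using dF'[of "axis i 1"] posG symmetric_matrix_inner[of "G ?x" \<nu> "axis i 1"]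
      by (simp add: partial_def pos_def_matrix_def flip: cong(2))
    then show ?thesis
      by (simp add: vec_eq_iff inner_axis)
  qed
  moreover have "g c p = G ?x"
    by (simp add: metric_coeff_def chart_inv_chart[OF c p(2)])
  ultimately have "deriv_norm A g f p = sqrt ((- \<sigma> *\<^sub>R (G ?x *v \<nu>)) \<bullet> (matrix_inv (G ?x) *v (- \<sigma> *\<^sub>R (G ?x *v \<nu>))))"
    unfolding deriv_norm_def Let_def chart[symmetric] by simp
  \<comment> \<open>The differential is the covector \<open>- \<sigma> G \<nu>\<close>. The inverse
    metric turns \<open>G \<nu>\<close> back into \<nu>, whose length is 1.\<close>
  also have "\<dots> = sqrt (\<sigma>\<^sup>2)"
    using \<nu> unfolding matrix_vector_mult_scaleR matrix_inv_mult_vec[OF pos_def_matrix_invertible[OF posG]]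
    by (simp add: inner_commute power2_eq_square)
  finally have dn: "deriv_norm A g f p = \<sigma>"
    using \<sigma> by simp
  have Gd: "G differentiable (at ?x)"
    using Ck_on_has_derivative[OF G_C1[unfolded One_nat_def] x(2)] differentiableI by blast
  have "eigenvalues UNIV ?g (hess_form G F ?x) = map ((*) \<sigma>) l @ [\<Lambda>]"
  proof (rule eigenvalues_append[OF g _ _ _ _ T \<sigma> _ l(2,3)])
    show "bilinear (hess_form G F ?x)"
      by (rule bilinear_hess_form[OF FO chart_range[OF c] x(2)])
    show "hess_form G F ?x v v' = hess_form G F ?x v' v" for v v'
      by (rule hess_form_commute[OF chart_range[OF c] x(2) pos_def_G Gd FO])
    show "\<nu> \<noteq> 0"
      using \<nu> by auto
    show "hess_form G F ?x \<nu> v = \<Lambda> * ?g \<nu> v" for v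
      using H\<nu> by (simp add: F_def[abs_def] metric_inner_eq[OF p(2)])
    show "hess_form G F ?x v v' = \<sigma> * ?II v v'" if "v \<in> ?T" "v' \<in> ?T" for v v'
      using HT[of v v'] hess[OF that] that
      by (simp add: F_def[abs_def] T metric_inner_eq[OF p(2)])
  qed (assumption | rule \<Lambda>)+
  then have "trace_hessian A g m f p = sum_list (take m (map ((*) \<sigma>) l @ [\<Lambda>]))"
    unfolding trace_hessian_def Let_def chart[symmetric] Hf by simp
  \<comment> \<open>The list \<open>l\<close> has \<open>CARD('n) - 1\<close> entries and
    \<open>m\<close> is at most that, so \<open>take m\<close> stops before \<Lambda>.\<close>
  also have "\<dots> = \<sigma> * (\<Sum>i<m. l ! i)"
    using sum_list_take_map_append m l(1) by simp
  also have "l = principal_curvatures X A g N p"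
    unfolding principal_curvatures_def Let_def chart[symmetric]
    using eigenvalues_unique[OF l(2,3)] by simp
  finally show ?thesis
    using that[OF fC2 fp fN \<sigma> dn] by simp
qed

end

theorem theorem1p2:
  fixes X :: "'a topology"
    and A :: "('a, 'n::finite) chart set"
    and g :: "('a, 'n) metric"
    and m :: nat and h :: real
    and Z N :: "'a set" and p :: 'a
  assumes "C1_riemannian_manifold X A g"
    and "m \<le> CARD('n) - 1"
    and "mh_subset X A g m h Z"
    and "smooth_region X A N"
    and "Z \<subseteq> N"
    and "p \<in> Z \<inter> X frontier_of N"
  shows "(\<Sum>i<m. principal_curvatures X A g N p ! i) \<le> h"
proof -
  interpret C1_riemannian_manifold X A g
    by (rule assms(1))
  have pZ: "p \<in> Z" "p \<in> X frontier_of N"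
    using assms(6) by auto
  have mh: "closedin X Z" "\<And>f p. Ck_function_on A 2 f (topspace X) \<Longrightarrow> local_max_on X f Z p \<Longrightarrow>
        trace_hessian A g m f p \<le> h * deriv_norm A g f p"
    using assms(3) by (auto simp: mh_subset_def)
  have pX: "p \<in> topspace X"
    using pZ closedin_subset[OF mh(1)] by blast
  let ?c = "chart_at A p"
  have "\<exists>c. c \<in> A \<and> p \<in> fst c"
    using pX charts_cover by blast
  then have chart: "?c \<in> A" "p \<in> fst ?c"
    unfolding chart_at_def by (metis (mono_tags, lifting) someI_ex)+
  obtain U w where U: "openin X U" "p \<in> U" and w: "smooth_function_on A w U"
    and reg: "\<forall>c\<in>A. \<forall>q \<in> U \<inter> fst c. frechet_derivative (w \<circ> chart_inv c) (at (snd c q)) \<noteq> (\<lambda>_. 0)"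
    and N: "closedin X N" "N \<inter> U = {q \<in> U. 0 \<le> w q}"
    using assms(4) pZ(2) unfolding smooth_region_def by blast
  interpret region_chart X A g N U w ?c
  proof
    show "Ck_function_on A 2 w U"
      using w by (simp add: smooth_function_on_def)
  qed (use U N reg chart in auto)
  obtain f \<sigma> where f: "Ck_function_on A 2 f (topspace X)" "f p = 0" "\<And>q. q \<in> N \<Longrightarrow> f q \<le> 0"
    and \<sigma>: "\<sigma> > 0" "deriv_norm A g f p = \<sigma>"
    "trace_hessian A g m f p = \<sigma> * (\<Sum>i<m. principal_curvatures X A g N p ! i)"
    using trace_hessian_test_function[OF U(2) chart(2) pZ(2) refl assms(2)] by blast
  \<comment> \<open>The maximum is global on \<open>Z\<close>, so the whole space serves as the
    neighbourhood.\<close>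
  have "local_max_on X f Z p"
    unfolding local_max_on_def using pZ pX f(2,3) assms(5)
    by (intro conjI exI[of _ "topspace X"]) auto
  from mh(2)[OF f(1) this] have "\<sigma> * (\<Sum>i<m. principal_curvatures X A g N p ! i) \<le> \<sigma> * h"
    by (simp add: \<sigma>(2,3) mult.commute)
  then show ?thesis
    using \<sigma>(1) by simp
qed

end
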